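(* Assume the standing hypotheses and the decomposition hypothesis of the context, that $\nu_\infty:=\dim\mathrm{Ker}\,B(\infty)=0$, that $\mathcal L(u)=\frac12(B(\infty)u,u)_H+o(\|u\|^2)$ as $\|u\|\to\infty$, and that $\|A(u)-B(\infty)u\|=o(\|u\|)$ as $u\in X$, $\|u\|\to\infty$. Let $\mu_\infty=\dim H^-_\infty$ and $\lambda=a_\infty/2$. (a) If $\mu_\infty=0$, then there exist $\mathfrak R>0$ and a homeomorphism $\phi$ from $B_H(\infty,\mathfrak R)$ onto an open subset of $H$ such that for all $u\in B_H(\infty,\mathfrak R)$, $$\mathcal L(\phi(u))=\|u\|^2,\qquad \frac{\|u\|}{\sqrt{2a_\infty}}\le\|\phi(u)\|\le\frac{1}{\sqrt{a_\infty-\lambda}}\|u\|.$$ (b) If $\mu_\infty>0$, then there exist $\mathfrak R>0$ and a homeomorphism $\phi$ from $B_{H^+_\infty}(\infty,\mathfrak R)\oplus H^-_\infty$ onto an open subset of $H$ such that for all $(u,v)\in B_{H^+_\infty}(\infty,\mathfrak R)\times H^-_\infty$, $$\mathcal L(\phi(u+v))=\|u\|^2-\|v\|^2,\qquad \frac{\|u\|}{\sqrt{2\|B(\infty)\|}}\le\|P^+_\infty\phi(u+v)\|\le\frac{\|u\|}{\sqrt{a_\infty-\lambda}},$$ and $P^-_\infty\circ\phi\bigl(B_{H^+_\infty}(\infty,\mathfrak R)\oplus H^-_\infty\bigr)=H^-_\infty$, where $P^+_\infty$, $P^-_\infty$ are the orthogonal projections onto $H^+_\infty$, $H^-_\inf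ty$.
   Context: Conventions. For a normed space $E$: $B_E(\infty,R)=\{\|x\|_E>R\}$. A neighborhood of infinity contains some $B_E(\infty,R)$. A map $f$ on an open set is continuously directional differentiable if $Df(x)(u)=\lim_{t\to0}(f(x+tu)-f(x))/t$ exists for all $x$, $u$ and $x\mapsto Df(x)(u)$ is continuous for each $u$. Standing hypotheses. $H$ is a real Hilbert space with inner product $(\cdot,\cdot)_H$ and norm $\|\cdot\|$; $X$ is a Banach space with norm $\|\cdot\|_X$, $X\subset H$ dense, $\|x\|\le\|x\|_X$ for $x\in X$. $V_\infty$ is an open neighborhood of infinity in $H$; $V_\infty^X$ is $V_\infty\cap X$ with the topology of $X$. $\mathcal L:V_\infty\to\mathbb R$ is continuous and continuously directional differentiable. There is a continuous and continuously directional differentiable $A:V^X_\infty\to X$ with $D\mathcal L(x)(u)=(A(x),u)_H$ for $x\in V_\infty\cap X$, $u\in X$. There is a map $B:(V_\infty\cap X)\cup\{\infty\}\to L_s(H)$ (bounded self-adjoint operators on $H$) with $B(\infty)(X)\subset X$ and $(DA(x)(u),v)_H=(B(x)u,v)_H$ for $x\in V_\infty\cap X$, $u,v\in X$. Either $0\notin\sigma(B(\infty))$ or $0$ is an isolated point of $\sigma(B(\infty))$. If $u\in H$ and $B(\infty)u\in X$, then $u\in X$. Decomposition hypothesis. $B(x)=P(x)+Q(x)$ for $x\in(V_\infty\cap X)\cup\{\infty\}$ with $P(x):H\to H$ positive definite linear and $Q(x):H\to H$ compact linear, such that: all eigenfunctions of $B(\infty)$ with negative eigenvalues lie in $X$;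 for every sequence $\{x_k\}\subset V_\infty\cap X$ with $\|x_k\|\to\infty$, $\|P(x_k)u-P(\infty)u\|\to0$ for all $u\in H$; $\|Q(x)-Q(\infty)\|_{L(H)}\to0$ as $x\in V_\infty\cap X$, $\|x\|\to\infty$; for every sequence $\{x_n\}\subset V_\infty\cap X$ with $\|x_n\|\to\infty$ there are $C_0>0$, $n_0$ with $(P(x_n)u,u)_H\ge C_0\|u\|^2$ for all $u\in H$, $n\ge n_0$. Notation. $H^+_\infty$ and $H^-_\infty$ are the positive and negative definite (spectral) subspaces of $B(\infty)$ (here $H=H^+_\infty\oplus H^-_\infty$, $\dim H^-_\infty<\infty$), and $a_\infty>0$ is a constant with $(B(\infty)u,u)_H\ge2a_\infty\|u\|^2$ for $u\in H^+_\infty$ and $(B(\infty)u,u)_H\le-2a_\infty\|u\|^2$ for $u\in H^-_\infty$.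
   Formalization: In (a) the lower bound is proved with the constant sqrt(2‖B(∞)‖) of (b) instead of sqrt(2a_∞), which fails for L(u)=50u² on R with a_∞=1; in (b) the equation for the image under P^-_∞ is claimed only if H^+_∞≠{0}, since otherwise the domain of φ is empty. *)

theory Defs
  imports "HOL-Analysis.Analysis" "HOL-Library.Landau_Symbols" "HOL-Library.Extended_Nat"
begin

text \<open>
  Conventions.  The Hilbert space \<open>H\<close> is a type of class real_inner and complete_space.
  The Banach space \<open>X\<close>, which has a norm and a topology of its own, is a type of class banach
  together with an injective linear map \<open>j\<close> into \<open>H\<close> (the inclusion), so that
  \<open>V \<inter> X\<close> with the topology of \<open>X\<close> is \<open>j -` V\<close>.  Maps given only on a subset
  are total functions whose values outside that subset are never used.  A family indexed by
  \<open>(V \<inter> X) \<union> {\<infinity>}\<close> is a function on \<open>X\<close> plus a separate operator for the index \<open>\<infinity>\<close>.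
\<close>

definition ball_infinity :: "'a::real_normed_vector set \<Rightarrow> real \<Rightarrow> 'a set" where
  "ball_infinity E R = {x \<in> E. norm x > R}"

definition neighborhood_of_infinity :: "'a::real_normed_vector set \<Rightarrow> bool" where
  "neighborhood_of_infinity V \<longleftrightarrow> (\<exists>R>0. ball_infinity UNIV R \<subseteq> V)"

definition has_dir_deriv ::
    "('a::real_normed_vector \<Rightarrow> 'b::real_normed_vector) \<Rightarrow> 'a \<Rightarrow> 'a \<Rightarrow> 'b \<Rightarrow> bool" where
  "has_dir_deriv f x u d \<longleftrightarrow> ((\<lambda>t::real. (f (x + t *\<^sub>R u) - f x) /\<^sub>R t) \<longlongrightarrow> d) (at 0)"

definition dir_deriv ::
    "('a::real_normed_vector \<Rightarrow> 'b::real_normed_vector) \<Rightarrow> 'a \<Rightarrow> 'a \<Rightarrow> 'b" where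
  "dir_deriv f x u = (THE d. has_dir_deriv f x u d)"

text \<open>Only meant for open \<open>S\<close>, where values of \<open>f\<close> outside \<open>S\<close> do not matter.\<close>

definition continuously_dir_differentiable_on ::
    "'a::real_normed_vector set \<Rightarrow> ('a \<Rightarrow> 'b::real_normed_vector) \<Rightarrow> bool" where
  "continuously_dir_differentiable_on S f \<longleftrightarrow>
     (\<forall>x\<in>S. \<forall>u. \<exists>d. has_dir_deriv f x u d) \<and>
     (\<forall>u. continuous_on S (\<lambda>x. dir_deriv f x u))"

definition self_adjoint :: "('h::real_inner \<Rightarrow>\<^sub>L 'h) \<Rightarrow> bool" where
  "self_adjoint T \<longleftrightarrow> (\<forall>u v. T u \<bullet> v = u \<bullet> T v)"

text \<open>Symmetry is not part of this notion; where it is used, that makes the hypothesis weaker.\<close>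

definition positive_definite :: "('h::real_inner \<Rightarrow>\<^sub>L 'h) \<Rightarrow> bool" where
  "positive_definite T \<longleftrightarrow> (\<forall>u. u \<noteq> 0 \<longrightarrow> T u \<bullet> u > 0)"

definition compact_operator :: "('a::real_normed_vector \<Rightarrow>\<^sub>L 'b::real_normed_vector) \<Rightarrow> bool" where
  "compact_operator T \<longleftrightarrow> compact (closure (blinfun_apply T ` cball 0 1))"

text \<open>Real spectrum; a self-adjoint operator has no other spectrum.\<close>

definition op_spectrum :: "('a::real_normed_vector \<Rightarrow>\<^sub>L 'a) \<Rightarrow> real set" where
  "op_spectrum T =
     {c. \<not> (\<exists>S. S o\<^sub>L (T - c *\<^sub>R id_blinfun) = id_blinfun \<and> (T - c *\<^sub>R id_blinfun) o\<^sub>L S = id_blinfun)}"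

definition op_kernel :: "('a::real_normed_vector \<Rightarrow>\<^sub>L 'b::real_normed_vector) \<Rightarrow> 'a set" where
  "op_kernel T = {u. T u = 0}"

text \<open>
  The positive (negative) definite spectral subspace of a self-adjoint \<open>T\<close>, i.e. the range of the
  spectral projection of \<open>T\<close> for \<open>(0,\<infinity>)\<close> (for \<open>(-\<infinity>,0)\<close>), is the largest closed
  \<open>T\<close>-invariant subspace on which \<open>T\<close> is positive (negative) definite: it is such a subspace, and
  any other one lies in it because spectral projections restrict to closed invariant subspaces.
\<close>

definition positive_subspace :: "('h::real_inner \<Rightarrow>\<^sub>L 'h) \<Rightarrow> 'h set" where
  "positive_subspace T =
     \<Union>{M. subspace M \<and> closed M \<and> blinfun_apply T ` M \<subseteq> M \<and> (\<forall>u\<in>M. u \<noteq> 0 \<longrightarrow> T u \<bullet> u > 0)}"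

definition negative_subspace :: "('h::real_inner \<Rightarrow>\<^sub>L 'h) \<Rightarrow> 'h set" where
  "negative_subspace T =
     \<Union>{M. subspace M \<and> closed M \<and> blinfun_apply T ` M \<subseteq> M \<and> (\<forall>u\<in>M. u \<noteq> 0 \<longrightarrow> T u \<bullet> u < 0)}"

definition orth_proj :: "'h::real_inner set \<Rightarrow> 'h \<Rightarrow> 'h" where
  "orth_proj M w = (THE p. p \<in> M \<and> (\<forall>m\<in>M. (w - p) \<bullet> m = 0))"

text \<open>\<^const>\<open>dim\<close> is \<open>0\<close> on infinite-dimensional subspaces; this version is \<open>\<infinity>\<close> there.\<close>

definition edim :: "'a::real_vector set \<Rightarrow> enat" where
  "edim S = (if \<exists>b. finite b \<and> S \<subseteq> span b then enat (dim S) else \<infinity>)"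

definition homeo_onto_open :: "'a::topological_space set \<Rightarrow> ('a \<Rightarrow> 'b::topological_space) \<Rightarrow> bool" where
  "homeo_onto_open D f \<longleftrightarrow> open (f ` D) \<and> (\<exists>g. homeomorphism D (f ` D) f g)"

text \<open>
  The theorem about these notions departs from its printed source in two places, because the printed
  text is false there.

  \<^item> For \<open>\<mu>\<^sub>\<infinity> = 0\<close> the printed lower bound for the norm of \<open>\<phi>(u)\<close> has the denominator
    \<open>sqrt (2 a\<^sub>\<infinity>)\<close>.  It fails for \<open>H = X = \<real>\<close>, \<open>L(u) = 50 u\<^sup>2\<close>, \<open>B = 100\<close>, \<open>a\<^sub>\<infinity> = 1\<close>.  The
    denominator of the case \<open>\<mu>\<^sub>\<infinity> > 0\<close>, with the operator norm of \<open>B(\<infinity>)\<close>, is used instead.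
  \<^item> For \<open>\<mu>\<^sub>\<infinity> > 0\<close> the equation that the projection to \<open>H\<^sup>-\<close> maps the image of \<open>\<phi>\<close> onto \<open>H\<^sup>-\<close>
    fails if \<open>H\<^sup>+ = {0}\<close>, since the domain of \<open>\<phi>\<close> is then empty.  That clause alone is restricted
    to \<open>H\<^sup>+ \<noteq> {0}\<close>.
\<close>

end

theory Submission
  imports Defs
begin

text \<open>
  The function \<open>L\<close> is a small perturbation, in a Lipschitz sense, of the quadratic form
  \<open>q x = (Binf x \<bullet> x) / 2\<close>. Indeed, along a segment between points of the dense subspace \<open>X\<close> the mean
  value theorem bounds the oscillation of \<open>G = L - q\<close> by the error of the gradient of \<open>L\<close>, which is
  \<open>o(\<parallel>x\<parallel>)\<close>, and continuity of \<open>L\<close> carries the bound over to all segments far from the origin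
  (lemma \<open>gradient_error_imp_lipschitz\<close>). Far enough out, the Lipschitz
  constant is as small a multiple of \<open>\<parallel>x\<parallel>\<close> as needed.

  Write \<open>x = u + v\<close> with \<open>u\<close> in \<open>H\<^sup>+\<close> and \<open>v\<close> in \<open>H\<^sup>-\<close>. The linear flow \<open>u + v \<mapsto> r u + v / r\<close> moves
  points along hyperbolas. On them \<open>q\<close> increases with \<open>r\<close> at a rate of at least a multiple of
  \<open>\<parallel>x\<parallel>\<^sup>2\<close>, which dominates the variation of \<open>G\<close>, so \<open>L\<close> is strictly increasing along them too. As
  \<open>\<bar>G x\<bar>\<close> is small against \<open>\<parallel>x\<parallel>\<^sup>2\<close>, for large \<open>u\<close> the equation \<open>L (r u + v / r) = q (u + v)\<close> has exactly one
  solution \<open>r\<close> in \<open>[3/4, 4/3]\<close>, and sliding each point by its own \<open>r\<close> is a map \<open>\<Phi>\<close> with \<open>L \<circ> \<Phi> = q\<close>.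
  Its inverse slides \<open>y\<close> along the same hyperbola to the point where \<open>q\<close> takes the value \<open>L y\<close>.
  Both solutions depend continuously on the point because they are roots of strictly monotone
  functions (lemmas \<open>monotone_root_continuous\<close> and \<open>straightening\<close>). Composing \<open>\<Phi>\<close> with a rescaling of
  \<open>u\<close> and \<open>v\<close> along their rays, which turns \<open>q\<close> into \<open>\<parallel>u\<parallel>\<^sup>2 - \<parallel>v\<parallel>\<^sup>2\<close>, gives \<open>\<phi>\<close> (theorem \<open>normal_form\<close>).
  The bounds on \<open>r\<close> give the norm estimates, since both \<open>3/4 \<ge> 1/2\<close> and \<open>4/3 \<le> sqrt 2\<close>.

  It remains to see that \<open>H\<close> is the orthogonal sum of the two spectral subspaces. The operator \<open>Pinf\<close>
  inherits coercivity from the \<open>P x\<close> at infinity, so \<open>Binf\<close> is coercive plus compact. A maximal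
  orthonormal set of eigenvectors with negative eigenvalues is then finite; its span is \<open>H\<^sup>-\<close>, and
  its orthogonal complement is \<open>H\<^sup>+\<close> (theorem \<open>spectral_subspaces_negative_eigenbasis\<close>). The case
  \<open>\<mu>\<^sub>\<infinity> = 0\<close> is the one in which that set is empty.
\<close>

section \<open>Orthonormal expansions\<close>

definition orthonormal :: "'a::real_inner set \<Rightarrow> bool" where
  "orthonormal S \<longleftrightarrow> pairwise orthogonal S \<and> (\<forall>e\<in>S. norm e = 1)"

definition proj_span :: "'a::real_inner set \<Rightarrow> 'a \<Rightarrow> 'a" where
  "proj_span S x = (\<Sum>e\<in>S. (x \<bullet> e) *\<^sub>R e)"

lemma proj_span_inner:
  assumes "finite S" "orthonormal S" "e \<in> S"
  shows "proj_span S x \<bullet> e = x \<bullet> e"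
proof -
  have "proj_span S x \<bullet> e = (\<Sum>e'\<in>S. (x \<bullet> e') * (e' \<bullet> e))"
    by (simp add: proj_span_def inner_sum_left)
  also have "\<dots> = (\<Sum>e'\<in>S. if e' = e then x \<bullet> e else 0)"
    using assms
    by (intro sum.cong) (auto simp: orthonormal_def pairwise_def orthogonal_def norm_eq_1)
  finally show ?thesis
    using assms by simp
qed

lemma bounded_linear_proj_span: "bounded_linear (proj_span S)"
  unfolding proj_span_def
  by (intro bounded_linear_sum bounded_linear_scaleR_const bounded_linear_inner_left)

lemma proj_span_in_span: "proj_span S x \<in> span S"
  unfolding proj_span_def by (intro span_sum span_scale span_base)

lemma inner_span_zero:
  assumes "v \<in> span S" "\<And>e. e \<in> S \<Longrightarrow> u \<bullet> e = 0"
  shows "u \<bullet> v = 0"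
  using assms(1)
proof (induction rule: span_induct)
  case base
  then show ?case by (simp add: subspace_def inner_add_right)
next
  case (step x)
  then show ?case using assms(2) by simp
qed

lemma residual_orthogonal_span:
  assumes "finite S" "orthonormal S" "v \<in> span S"
  shows "(x - proj_span S x) \<bullet> v = 0"
  by (rule inner_span_zero[OF assms(3)]) (simp add: inner_diff_left proj_span_inner assms)

text \<open>
  \<^const>\<open>dim\<close> counts the vectors of a basis, so it can be \<open>0\<close> without the set being trivial if only
  infinite bases exist. The finite spanning set that is part of a finite \<^const>\<open>edim\<close> excludes this.
\<close>

lemma edim_eq_0D:
  assumes "edim S = 0"
  shows "S \<subseteq> {0}"
proof -
  obtain b where b: "finite b" "S \<subseteq> span b" and d: "dim S = 0"
    using assms by (auto simp: edim_def zero_enat_def split: if_splits)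
  obtain B where B: "B \<subseteq> S" "independent B" "S \<subseteq> span B" "card B = dim S"
    using basis_exists by blast
  have "finite B"
    using independent_span_bound[OF b(1) B(2)] B(1) b(2) by blast
  then show ?thesis
    using B d by auto
qed

lemma orth_proj_eq:
  assumes "subspace M" "p \<in> M" "\<And>m. m \<in> M \<Longrightarrow> (w - p) \<bullet> m = 0"
  shows "orth_proj M w = p"
  unfolding orth_proj_def
proof (rule the_equality)
  show "p \<in> M \<and> (\<forall>m\<in>M. (w - p) \<bullet> m = 0)"
    using assms by blast
next
  fix p' assume p': "p' \<in> M \<and> (\<forall>m\<in>M. (w - p') \<bullet> m = 0)"
  have "p' - p \<in> M" using p' assms subspace_diff by blast
  then have "(w - p) \<bullet> (p' - p) - (w - p') \<bullet> (p' - p) = 0"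
    using p' assms by simp
  then have "(p' - p) \<bullet> (p' - p) = 0"
    by (simp add: inner_diff_left)
  then show "p' = p" by simp
qed

section \<open>Self-adjoint operators that are coercive up to a compact operator\<close>

text \<open>
  This is the Cauchy-Schwarz inequality for the semidefinite form \<open>T u \<bullet> v\<close>, applied to \<open>x\<close> and \<open>T x\<close>.
  It turns a small value of the form into a small image, so that an almost minimizer of a form
  is an almost eigenvector.
\<close>

lemma norm_image_le_form:
  fixes T :: "'h::real_inner \<Rightarrow>\<^sub>L 'h"
  assumes sa: "self_adjoint T" and N: "subspace N" "blinfun_apply T ` N \<subseteq> N"
    and nonneg: "\<And>u. u \<in> N \<Longrightarrow> 0 \<le> T u \<bullet> u" and x: "x \<in> N"
  shows "(norm (T x))\<^sup>2 \<le> norm T * (T x \<bullet> x)"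
proof (cases "norm T = 0")
  case True
  then show ?thesis by simp
next
  case False
  then have pos: "norm T > 0" by simp
  define t where "t = 1 / norm T"
  define y where "y = T x"
  have "x - t *\<^sub>R y \<in> N"
    using N x unfolding y_def by (intro subspace_diff subspace_scale) auto
  then have "0 \<le> T (x - t *\<^sub>R y) \<bullet> (x - t *\<^sub>R y)"
    by (rule nonneg)
  also have "\<dots> = T x \<bullet> x - t * (T x \<bullet> y) - t * (T y \<bullet> x) + t\<^sup>2 * (T y \<bullet> y)"
    by (simp add: blinfun.diff_right blinfun.scaleR_right inner_diff_left inner_diff_right
        algebra_simps power2_eq_square)
  also have "T y \<bullet> x = y \<bullet> y"
    using sa unfolding self_adjoint_def y_def by auto
  also have "T x \<bullet> y = y \<bullet> y" by (simp add: y_def)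
  finally have 1: "0 \<le> T x \<bullet> x - 2 * t * (y \<bullet> y) + t\<^sup>2 * (T y \<bullet> y)"
    by simp
  have "T y \<bullet> y \<le> norm (T y) * norm y" by (rule norm_cauchy_schwarz)
  also have "\<dots> \<le> norm T * norm y * norm y"
    by (intro mult_right_mono norm_blinfun) auto
  finally have "T y \<bullet> y \<le> norm T * (y \<bullet> y)"
    by (simp add: dot_square_norm power2_eq_square)
  then have "t\<^sup>2 * (T y \<bullet> y) \<le> t\<^sup>2 * (norm T * (y \<bullet> y))"
    by (intro mult_left_mono) auto
  also have "\<dots> = t * (y \<bullet> y)"
    using pos by (simp add: t_def power2_eq_square field_simps)
  finally have "t * (y \<bullet> y) \<le> T x \<bullet> x"
    using 1 by simp
  then show ?thesis
    using pos by (simp add: t_def y_def dot_square_norm field_simps)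
qed

text \<open>
  Coercivity bounds \<open>C \<parallel>d\<parallel>\<close> by \<open>\<parallel>P d - c d\<parallel>\<close> for every difference \<open>d\<close> of members of the sequence.
\<close>

lemma coercive_cauchy:
  fixes P :: "'h::real_inner \<Rightarrow>\<^sub>L 'h" and c :: real
  assumes "\<And>u. C * (norm u)\<^sup>2 \<le> P u \<bullet> u" "C > 0" and c: "c \<le> 0"
    and "Cauchy (\<lambda>n. P (x n) - c *\<^sub>R x n)"
  shows "Cauchy x"
proof (rule metric_CauchyI)
  fix e :: real assume "e > 0"
  then obtain M where M: "\<And>m n. m \<ge> M \<Longrightarrow> n \<ge> M \<Longrightarrow>
      dist (P (x m) - c *\<^sub>R x m) (P (x n) - c *\<^sub>R x n) < C * e"
    using metric_CauchyD[OF assms(4), of "C * e"] \<open>C > 0\<close> by auto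
  show "\<exists>M. \<forall>m\<ge>M. \<forall>n\<ge>M. dist (x m) (x n) < e"
  proof (intro exI allI impI)
    fix m n assume mn: "m \<ge> M" "n \<ge> M"
    define d where "d = x m - x n"
    have "C * (norm d)\<^sup>2 \<le> P d \<bullet> d" by (rule assms)
    also have "\<dots> \<le> (P d - c *\<^sub>R d) \<bullet> d"
      using c by (simp add: inner_diff_left mult_nonpos_nonneg)
    also have "\<dots> \<le> norm (P d - c *\<^sub>R d) * norm d" by (rule norm_cauchy_schwarz)
    finally have 1: "C * norm d * norm d \<le> norm (P d - c *\<^sub>R d) * norm d"
      by (simp add: power2_eq_square)
    have 2: "norm (P d - c *\<^sub>R d) < C * e"
      using M[OF mn] by (simp add: d_def dist_norm blinfun.diff_right algebra_simps)
    have "norm d < e"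
    proof (cases "d = 0")
      case True then show ?thesis using \<open>e > 0\<close> by simp
    next
      case False
      then have "C * norm d \<le> norm (P d - c *\<^sub>R d)" using 1 by simp
      then have "C * norm d < C * e" using 2 by simp
      then show ?thesis using \<open>C > 0\<close> by simp
    qed
    then show "dist (x m) (x n) < e" by (simp add: d_def dist_norm)
  qed
qed

lemma compact_operator_convergent_subseq:
  assumes "compact_operator Q" "\<And>n. norm (x n) \<le> 1"
  shows "\<exists>l r. strict_mono (r :: nat \<Rightarrow> nat) \<and> (\<lambda>n. Q (x (r n))) \<longlonglongrightarrow> l"
proof -
  have "\<forall>n. Q (x n) \<in> closure (blinfun_apply Q ` cball 0 1)"
    using assms(2) closure_subset[of "blinfun_apply Q ` cball 0 1"] by auto
  then obtain l r where "strict_mono (r :: nat \<Rightarrow> nat)" "((\<lambda>n. Q (x n)) \<circ> r) \<longlonglongrightarrow> l"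
    using seq_compactE[OF compact_imp_seq_compact] assms(1)
    unfolding compact_operator_def by metis
  then show ?thesis by (auto simp: o_def)
qed

text \<open>
  Minimize \<open>T u \<bullet> u\<close> over the unit vectors of \<open>N\<close>. A minimizing sequence consists of almost
  eigenvectors for the infimum \<open>c\<close>. Along a subsequence the compact part converges, hence so does
  \<open>P x - c x\<close>, and as \<open>c < 0\<close> the coercive part forces the sequence itself to converge. This replaces
  weak compactness of the unit ball.
\<close>

lemma negative_eigenvector_exists:
  fixes T P Q :: "'h::{real_inner, complete_space} \<Rightarrow>\<^sub>L 'h"
  assumes sa: "self_adjoint T" and N: "subspace N" "closed N" "blinfun_apply T ` N \<subseteq> N"
    and split: "T = P + Q" and Q: "compact_operator Q"
    and P: "\<And>u. C * (norm u)\<^sup>2 \<le> P u \<bullet> u" "C > 0"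
    and u0: "u0 \<in> N" "T u0 \<bullet> u0 < 0"
  shows "\<exists>e\<in>N. norm e = 1 \<and> (\<exists>c<0. T e = c *\<^sub>R e)"
proof -
  define W where "W = (\<lambda>u. T u \<bullet> u) ` {u \<in> N. norm u = 1}"
  define c where "c = Inf W"
  have bd: "bdd_below W"
  proof (rule bdd_belowI)
    fix w assume "w \<in> W"
    then obtain u where u: "norm u = 1" "w = T u \<bullet> u" by (auto simp: W_def)
    have "\<bar>T u \<bullet> u\<bar> \<le> norm (T u) * norm u" by (rule Cauchy_Schwarz_ineq2)
    also have "\<dots> \<le> norm T" using norm_blinfun[of T u] u by simp
    finally show "- norm T \<le> w" using u by simp
  qed
  have normalized: "T u \<bullet> u = (norm u)\<^sup>2 * (T (u /\<^sub>R norm u) \<bullet> (u /\<^sub>R norm u))" for u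
    by (cases "u = 0") (simp_all add: blinfun.scaleR_right power2_eq_square field_simps)
  have unit: "T (u /\<^sub>R norm u) \<bullet> (u /\<^sub>R norm u) \<in> W" if "u \<in> N" "u \<noteq> 0" for u
    unfolding W_def using that N(1) by (intro imageI) (auto simp: subspace_scale)
  have lower: "c * (norm u)\<^sup>2 \<le> T u \<bullet> u" if "u \<in> N" for u
  proof (cases "u = 0")
    case False
    show ?thesis
      using cInf_lower[OF unit[OF that False] bd] unfolding normalized[of u] c_def
      by (metis mult.commute mult_left_mono zero_le_power2)
  qed simp
  have u0': "u0 \<noteq> 0" using u0 by auto
  have cneg: "c < 0"
  proof -
    have "c * (norm u0)\<^sup>2 < 0" using lower[OF u0(1)] u0(2) by simp
    then show ?thesis using u0' by (simp add: mult_less_0_iff)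
  qed
  define S where "S = T - c *\<^sub>R id_blinfun"
  have S_app: "S u = T u - c *\<^sub>R u" for u
    by (simp add: S_def blinfun.diff_left blinfun.scaleR_left)
  have S_sa: "self_adjoint S"
    using sa by (auto simp: self_adjoint_def S_app inner_diff_left inner_diff_right)
  have S_inv: "blinfun_apply S ` N \<subseteq> N"
    using N by (auto simp: S_app intro!: subspace_diff subspace_scale)
  have S_form: "S u \<bullet> u = T u \<bullet> u - c * (norm u)\<^sup>2" for u
    by (simp add: S_app inner_diff_left dot_square_norm)
  have S_nonneg: "0 \<le> S u \<bullet> u" if "u \<in> N" for u
    using lower[OF that] by (simp add: S_form)
  have ne: "W \<noteq> {}" using unit[OF u0(1) u0'] by blast
  have "\<exists>u. u \<in> N \<and> norm u = 1 \<and> T u \<bullet> u < c + inverse (real (Suc n))" for n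
  proof -
    have "\<exists>w\<in>W. w < c + inverse (real (Suc n))"
      by (rule cInf_lessD[OF ne]) (simp add: c_def[symmetric])
    then show ?thesis by (auto simp: W_def)
  qed
  then obtain x where x: "\<And>n. x n \<in> N" "\<And>n. norm (x n) = 1"
      "\<And>n. T (x n) \<bullet> x n < c + inverse (real (Suc n))"
    by metis
  have lim0: "(\<lambda>n. S (x n)) \<longlonglongrightarrow> 0"
  proof (rule Lim_null_comparison)
    show "\<forall>\<^sub>F n in sequentially. norm (S (x n)) \<le> sqrt (norm S * inverse (real (Suc n)))"
    proof (intro always_eventually allI)
      fix n
      have "(norm (S (x n)))\<^sup>2 \<le> norm S * (S (x n) \<bullet> x n)"
        by (rule norm_image_le_form[OF S_sa N(1) S_inv S_nonneg x(1)])
      also have "\<dots> \<le> norm S * inverse (real (Suc n))"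
        using x(2)[of n] x(3)[of n] by (intro mult_left_mono) (auto simp: S_form)
      finally show "norm (S (x n)) \<le> sqrt (norm S * inverse (real (Suc n)))"
        by (rule real_le_rsqrt)
    qed
    have "(\<lambda>n. sqrt (norm S * inverse (real (Suc n)))) \<longlonglongrightarrow> sqrt (norm S * 0)"
      by (intro tendsto_intros LIMSEQ_inverse_real_of_nat)
    then show "(\<lambda>n. sqrt (norm S * inverse (real (Suc n)))) \<longlonglongrightarrow> 0" by simp
  qed
  obtain l r where r: "strict_mono (r :: nat \<Rightarrow> nat)" and l: "(\<lambda>n. Q (x (r n))) \<longlonglongrightarrow> l"
    using compact_operator_convergent_subseq[OF Q, of x] x(2) by auto
  have "(\<lambda>n. S (x (r n)) - Q (x (r n))) \<longlonglongrightarrow> 0 - l"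
    using LIMSEQ_subseq_LIMSEQ[OF lim0 r] l by (intro tendsto_diff) (auto simp: o_def)
  moreover have "S (x (r n)) - Q (x (r n)) = P (x (r n)) - c *\<^sub>R x (r n)" for n
    by (simp add: S_app split blinfun.add_left)
  ultimately have "Cauchy (\<lambda>n. P (x (r n)) - c *\<^sub>R x (r n))"
    using LIMSEQ_imp_Cauchy by auto
  then have "Cauchy (\<lambda>n. x (r n))"
    using coercive_cauchy[OF P, of c "\<lambda>n. x (r n)"] cneg by simp
  then obtain e where e: "(\<lambda>n. x (r n)) \<longlonglongrightarrow> e"
    using Cauchy_convergent convergent_def by blast
  have "e \<in> N"
    using closed_sequentially[OF N(2) _ e] x(1) by blast
  moreover have "norm e = 1"
    using tendsto_norm[OF e] x(2) LIMSEQ_unique[OF _ tendsto_const] by simp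
  moreover have "(\<lambda>n. S (x (r n))) \<longlonglongrightarrow> S e"
    by (intro tendsto_intros e)
  then have "S e = 0"
    using LIMSEQ_subseq_LIMSEQ[OF lim0 r] LIMSEQ_unique by (auto simp: o_def)
  then have "T e = c *\<^sub>R e" by (simp add: S_app)
  ultimately show ?thesis using cneg by blast
qed

text \<open>
  The difference of two members has norm \<open>sqrt 2\<close> and makes the form of \<open>T\<close> negative, so the
  coercivity of \<open>P\<close> keeps the images under \<open>Q\<close> of distinct members at least \<open>C\<close> apart. A compact
  operator admits no infinite family of that kind.
\<close>

lemma finite_orthonormal_negative_eigenvectors:
  fixes T P Q :: "'h::real_inner \<Rightarrow>\<^sub>L 'h"
  assumes split: "T = P + Q" and Q: "compact_operator Q"
    and P: "\<And>u. C * (norm u)\<^sup>2 \<le> P u \<bullet> u" "C > 0"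
    and S: "orthonormal S" "\<And>e. e \<in> S \<Longrightarrow> \<exists>c<0. T e = c *\<^sub>R e"
  shows "finite S"
proof (rule ccontr)
  assume "infinite S"
  then obtain f :: "nat \<Rightarrow> 'h" where f: "inj f" "range f \<subseteq> S"
    using infinite_countable_subset by blast
  have fn: "norm (f n) = 1" for n using f S(1) by (auto simp: orthonormal_def)
  obtain l r where r: "strict_mono (r :: nat \<Rightarrow> nat)" and l: "(\<lambda>n. Q (f (r n))) \<longlonglongrightarrow> l"
    using compact_operator_convergent_subseq[OF Q, of f] fn by auto
  then obtain M where M: "\<And>m n. m \<ge> M \<Longrightarrow> n \<ge> M \<Longrightarrow> dist (Q (f (r m))) (Q (f (r n))) < C"
    using metric_CauchyD[OF LIMSEQ_imp_Cauchy[OF l] P(2)] by blast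
  define x y where "x = f (r M)" and "y = f (r (Suc M))"
  have "r M \<noteq> r (Suc M)" using r by (metis lessI less_irrefl strict_mono_less)
  then have "x \<noteq> y" using f(1) by (auto simp: x_def y_def inj_eq)
  moreover have xy: "x \<in> S" "y \<in> S" using f(2) by (auto simp: x_def y_def)
  ultimately have o: "x \<bullet> y = 0" "y \<bullet> x = 0" "norm x = 1" "norm y = 1"
    using S(1) by (auto simp: orthonormal_def pairwise_def orthogonal_def)
  obtain cx cy where c: "cx < 0" "T x = cx *\<^sub>R x" "cy < 0" "T y = cy *\<^sub>R y"
    using S(2)[OF xy(1)] S(2)[OF xy(2)] by blast
  have xx: "x \<bullet> x = 1" "y \<bullet> y = 1" using o(3,4) by (simp_all add: norm_eq_1)
  have n2: "(norm (x - y))\<^sup>2 = 2"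
    by (simp add: power2_norm_eq_inner inner_diff_left inner_diff_right o xx)
  then have n: "norm (x - y) \<le> 2"
    using power2_le_imp_le[of "norm (x - y)" 2] by simp
  have "T (x - y) \<bullet> (x - y) = cx + cy"
    by (simp add: blinfun.diff_right c inner_diff_left inner_diff_right o xx)
  then have "T (x - y) \<bullet> (x - y) < 0" using c by simp
  then have "P (x - y) \<bullet> (x - y) + Q (x - y) \<bullet> (x - y) < 0"
    by (simp add: split blinfun.add_left inner_add_left)
  then have "2 * C < - (Q (x - y) \<bullet> (x - y))"
    using P(1)[of "x - y"] n2 by simp
  also have "\<dots> \<le> norm (Q (x - y)) * norm (x - y)"
    using Cauchy_Schwarz_ineq2[of "Q (x - y)" "x - y"] by linarith
  also have "\<dots> \<le> norm (Q (x - y)) * 2" by (intro mult_left_mono n) auto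
  finally have "C < norm (Q (x - y))" by simp
  moreover have "norm (Q (x - y)) < C"
    using M[of M "Suc M"] by (simp add: x_def y_def dist_norm blinfun.diff_right)
  ultimately show False by simp
qed

lemma inner_eigenvector_image_zero:
  assumes "self_adjoint T" "T e = c *\<^sub>R e" "u \<bullet> e = 0"
  shows "T u \<bullet> e = 0"
  using assms by (simp add: self_adjoint_def)

text \<open>
  A set that is maximal by Zorn's lemma works: were the form negative somewhere on the orthogonal
  complement within \<open>N\<close>, which is again closed and invariant, that complement would contain a
  further eigenvector.
\<close>

lemma finite_negative_eigenbasis:
  fixes T P Q :: "'h::{real_inner, complete_space} \<Rightarrow>\<^sub>L 'h"
  assumes sa: "self_adjoint T" and N: "subspace N" "closed N" "blinfun_apply T ` N \<subseteq> N"
    and split: "T = P + Q" and Q: "compact_operator Q"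
    and P: "\<And>u. C * (norm u)\<^sup>2 \<le> P u \<bullet> u" "C > 0"
  shows "\<exists>S\<subseteq>N. finite S \<and> orthonormal S \<and> (\<forall>e\<in>S. \<exists>c<0. T e = c *\<^sub>R e) \<and>
           (\<forall>u\<in>N. (\<forall>e\<in>S. u \<bullet> e = 0) \<longrightarrow> 0 \<le> T u \<bullet> u)"
proof -
  define F where "F = {S. S \<subseteq> N \<and> orthonormal S \<and> (\<forall>e\<in>S. \<exists>c<0. T e = c *\<^sub>R e)}"
  have "\<exists>S\<in>F. \<forall>S'\<in>F. S \<subseteq> S' \<longrightarrow> S' = S"
  proof (rule subset_Zorn)
    fix K assume K: "subset.chain F K"
    have "\<Union>K \<in> F"
      unfolding F_def
    proof (intro CollectI conjI)
      show "\<Union>K \<subseteq> N" "\<forall>e\<in>\<Union>K. \<exists>c<0. T e = c *\<^sub>R e"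
        using K by (auto simp: subset_chain_def F_def)
      have "orthogonal x y" if xy: "x \<in> \<Union>K" "y \<in> \<Union>K" "x \<noteq> y" for x y
      proof -
        obtain S where "S \<in> K" "x \<in> S" "y \<in> S"
          using K xy unfolding subset_chain_def by blast
        then have "pairwise orthogonal S" using K by (auto simp: subset_chain_def F_def orthonormal_def)
        with \<open>x \<in> S\<close> \<open>y \<in> S\<close> xy(3) show ?thesis by (auto simp: pairwise_def)
      qed
      then show "orthonormal (\<Union>K)"
        using K by (fastforce simp: orthonormal_def pairwise_def subset_chain_def F_def)
    qed
    then show "\<exists>U\<in>F. \<forall>X\<in>K. X \<subseteq> U" by blast
  qed
  then obtain S where S: "S \<in> F" and max: "\<And>S'. S' \<in> F \<Longrightarrow> S \<subseteq> S' \<Longrightarrow> S' = S" by blast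
  then have S': "S \<subseteq> N" "orthonormal S" and eig: "\<And>e. e \<in> S \<Longrightarrow> \<exists>c<0. T e = c *\<^sub>R e"
    by (auto simp: F_def)
  have fin: "finite S"
    by (rule finite_orthonormal_negative_eigenvectors[OF split Q P S'(2) eig])
  define N' where "N' = N \<inter> {u. \<forall>e\<in>S. u \<bullet> e = 0}"
  have "closed {u. \<forall>e\<in>S. u \<bullet> e = 0}"
    unfolding Ball_def
    by (intro closed_Collect_all closed_Collect_imp closed_Collect_eq open_Collect_const
        continuous_intros)
  then have "closed N'" unfolding N'_def using N(2) by (rule closed_Int[rotated])
  moreover have "subspace N'"
    unfolding N'_def using N(1) by (auto simp: subspace_def inner_add_left)
  moreover have "blinfun_apply T ` N' \<subseteq> N'"
    using N(3) eig inner_eigenvector_image_zero[OF sa] unfolding N'_def by blast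
  ultimately have N': "subspace N'" "closed N'" "blinfun_apply T ` N' \<subseteq> N'" by auto
  have "0 \<le> T u \<bullet> u" if u: "u \<in> N" "\<forall>e\<in>S. u \<bullet> e = 0" for u
  proof (rule ccontr)
    assume "\<not> 0 \<le> T u \<bullet> u"
    moreover have "u \<in> N'" using u by (simp add: N'_def)
    ultimately obtain e where e: "e \<in> N'" "norm e = 1" "\<exists>c<0. T e = c *\<^sub>R e"
      using negative_eigenvector_exists[OF sa N' split Q P] by force
    then have "insert e S \<in> F"
      using S by (auto simp: F_def N'_def orthonormal_def pairwise_insert orthogonal_def
          inner_commute)
    then have "e \<in> S" using max[of "insert e S"] by blast
    then have "e \<bullet> e = 0" using e by (simp add: N'_def)
    then show False using e by simp
  qed
  then show ?thesis using S' fin eig by blast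
qed

text \<open>
  The operator \<open>S = T - c\<close> is coercive on \<open>N\<close>, and its range is orthogonal to \<open>e\<close>. Hence
  \<open>u \<bullet> e\<close> does not change when \<open>u\<close> is replaced by \<open>u - t S u\<close>, which for a suitable \<open>t\<close> is a
  contraction of \<open>N\<close>. Iteration drives the product to \<open>0\<close> without any orthogonal projection to \<open>N\<close>.
\<close>

lemma positive_invariant_orthogonal_negative_eigenvector:
  fixes T :: "'h::real_inner \<Rightarrow>\<^sub>L 'h"
  assumes sa: "self_adjoint T" and N: "subspace N" "blinfun_apply T ` N \<subseteq> N"
    and nonneg: "\<And>u. u \<in> N \<Longrightarrow> 0 \<le> T u \<bullet> u"
    and e: "T e = c *\<^sub>R e" "c < 0" and u: "u \<in> N"
  shows "u \<bullet> e = 0"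
proof -
  define S where "S = T - c *\<^sub>R id_blinfun"
  have S_app: "S u = T u - c *\<^sub>R u" for u
    by (simp add: S_def blinfun.diff_left blinfun.scaleR_left)
  have S_e: "S w \<bullet> e = 0" for w
    using sa e by (simp add: S_app inner_diff_left self_adjoint_def)
  \<comment> \<open>The summand 1 makes K positive, and K dominates both the norm of S and - c; t minimizes the
    bound 1 + 2 c t + K^2 t^2 for the squared contraction factor.\<close>
  define K where "K = norm S + 1 - c"
  have K: "K > 0" "norm S \<le> K" "- c \<le> K" using e norm_ge_zero[of S] unfolding K_def by linarith+
  define t where "t = - c / K\<^sup>2"
  define k where "k = sqrt (1 - c\<^sup>2 / K\<^sup>2)"
  have cK: "0 < c\<^sup>2 / K\<^sup>2" using K e by simp
  have "c\<^sup>2 \<le> K\<^sup>2" using K e power_mono[of "- c" K 2] by simp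
  then have cK1: "c\<^sup>2 / K\<^sup>2 \<le> 1" using K by (simp add: divide_le_eq_1)
  have k: "0 \<le> k" "k < 1" using cK cK1 by (auto simp: k_def real_sqrt_lt_1_iff)
  have contr: "norm (w - t *\<^sub>R S w) \<le> k * norm w" if "w \<in> N" for w
  proof -
    have Sw: "- c * (norm w)\<^sup>2 \<le> S w \<bullet> w"
      using nonneg[OF that] by (simp add: S_app inner_diff_left dot_square_norm)
    have "norm (S w) \<le> K * norm w"
      using norm_blinfun[of S w] K by (meson mult_right_mono norm_ge_zero order_trans)
    then have nS: "(norm (S w))\<^sup>2 \<le> K\<^sup>2 * (norm w)\<^sup>2"
      by (metis norm_ge_zero power_mono power_mult_distrib)
    have t: "t \<ge> 0" using e by (simp add: t_def divide_nonpos_nonneg)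
    have "(norm (w - t *\<^sub>R S w))\<^sup>2 = (norm w)\<^sup>2 - 2 * t * (S w \<bullet> w) + t\<^sup>2 * (norm (S w))\<^sup>2"
      unfolding power2_norm_eq_inner
      by (simp add: inner_diff_left inner_diff_right inner_commute power2_eq_square)
    also have "\<dots> \<le> (norm w)\<^sup>2 - 2 * t * (- c * (norm w)\<^sup>2) + t\<^sup>2 * (K\<^sup>2 * (norm w)\<^sup>2)"
      using t Sw nS by (intro add_mono diff_mono mult_left_mono order_refl) auto
    also have "\<dots> = (1 - c\<^sup>2 / K\<^sup>2) * (norm w)\<^sup>2"
      using K unfolding t_def by (simp add: field_simps power2_eq_square)
    also have "\<dots> = (k * norm w)\<^sup>2"
      using cK1 by (simp add: k_def power_mult_distrib)
    finally show ?thesis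
      by (rule power2_le_imp_le) (use k in simp)
  qed
  have "\<bar>w \<bullet> e\<bar> \<le> k ^ n * (norm w * norm e)" if "w \<in> N" for n w
    using that
  proof (induction n arbitrary: w)
    case 0
    then show ?case by (simp add: Cauchy_Schwarz_ineq2)
  next
    case (Suc n)
    have "w - t *\<^sub>R S w \<in> N"
      using Suc.prems N by (auto simp: S_app intro!: subspace_diff subspace_scale)
    from Suc.IH[OF this] have "\<bar>w \<bullet> e\<bar> \<le> k ^ n * (norm (w - t *\<^sub>R S w) * norm e)"
      by (simp add: inner_diff_left S_e)
    also have "\<dots> \<le> k ^ n * (k * norm w * norm e)"
      using k contr[OF Suc.prems] by (intro mult_left_mono mult_right_mono) auto
    finally show ?case by (simp add: mult_ac)
  qed
  from this[OF u] have *: "\<bar>u \<bullet> e\<bar> \<le> k ^ n * (norm u * norm e)" for n .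
  have "(\<lambda>n. k ^ n * (norm u * norm e)) \<longlonglongrightarrow> 0 * (norm u * norm e)"
    using k by (intro tendsto_intros LIMSEQ_power_zero) auto
  then have "\<bar>u \<bullet> e\<bar> \<le> 0 * (norm u * norm e)"
    by (rule LIMSEQ_le_const) (use * in blast)
  then show ?thesis by simp
qed

text \<open>
  The orthogonal complement \<open>Z\<close> of a maximal set of negative eigenvectors is closed, invariant and
  positive definite (the form is nonnegative there, and it vanishes only on the kernel). Every other
  positive definite invariant subspace is orthogonal to the eigenvectors, so \<open>Z\<close> is the largest one.
  A negative definite closed invariant subspace \<open>N\<close> is itself spanned by negative eigenvectors, which
  are orthogonal to \<open>Z\<close>, so \<open>N\<close> lies in the span of the set.
\<close>

theorem spectral_subspaces_negative_eigenbasis: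
  fixes T P Q :: "'h::{real_inner, complete_space} \<Rightarrow>\<^sub>L 'h"
  assumes sa: "self_adjoint T"
    and split: "T = P + Q" and Q: "compact_operator Q"
    and P: "\<And>u. C * (norm u)\<^sup>2 \<le> P u \<bullet> u" "C > 0"
    and ker: "\<And>u. T u = 0 \<Longrightarrow> u = 0"
  shows "\<exists>S. finite S \<and> orthonormal S \<and> (\<forall>e\<in>S. \<exists>c<0. T e = c *\<^sub>R e) \<and>
           positive_subspace T = {u. \<forall>e\<in>S. u \<bullet> e = 0} \<and> negative_subspace T = span S"
proof -
  obtain S where S: "finite S" "orthonormal S" and eig: "\<forall>e\<in>S. \<exists>c<0. T e = c *\<^sub>R e"
    and nonneg: "\<And>u. (\<forall>e\<in>S. u \<bullet> e = 0) \<Longrightarrow> 0 \<le> T u \<bullet> u"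
    using finite_negative_eigenbasis[OF sa _ _ _ split Q P, of UNIV] by auto
  define Z where "Z = {u. \<forall>e\<in>S. u \<bullet> e = 0}"
  have Z: "subspace Z" by (auto simp: Z_def subspace_def inner_add_left)
  have Zc: "closed Z"
    unfolding Z_def Ball_def
    by (intro closed_Collect_all closed_Collect_imp closed_Collect_eq open_Collect_const
        continuous_intros)
  have Zi: "blinfun_apply T ` Z \<subseteq> Z"
    using eig inner_eigenvector_image_zero[OF sa] unfolding Z_def by blast
  have Znn: "0 \<le> T u \<bullet> u" if "u \<in> Z" for u using nonneg that by (simp add: Z_def)
  have Zpos: "0 < T u \<bullet> u" if "u \<in> Z" "u \<noteq> 0" for u
  proof (rule ccontr)
    assume "\<not> 0 < T u \<bullet> u"
    then have "T u \<bullet> u = 0" using Znn that by force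
    then have "T u = 0"
      using norm_image_le_form[OF sa Z Zi Znn that(1)] by simp
    then show False using ker that by blast
  qed
  have spanneg: "T u \<bullet> u < 0" if u_in: "u \<in> span S" and u_ne: "u \<noteq> 0" for u
  proof -
    have u: "u = proj_span S u"
    proof -
      have "u - proj_span S u \<in> span S" using that proj_span_in_span span_diff by blast
      then have "(u - proj_span S u) \<bullet> (u - proj_span S u) = 0"
        by (rule residual_orthogonal_span[OF S])
      then show ?thesis by simp
    qed
    obtain c where c: "\<And>e. e \<in> S \<Longrightarrow> c e < 0 \<and> T e = c e *\<^sub>R e" using eig by metis
    have "T u \<bullet> u = (\<Sum>e\<in>S. (u \<bullet> e) * (T u \<bullet> e))"
      by (subst (2) u) (simp add: proj_span_def inner_sum_right)
    also have "\<dots> = (\<Sum>e\<in>S. c e * (u \<bullet> e)\<^sup>2)"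
      using c sa by (intro sum.cong) (auto simp: self_adjoint_def power2_eq_square)
    finally have eq: "T u \<bullet> u = (\<Sum>e\<in>S. c e * (u \<bullet> e)\<^sup>2)" .
    obtain e where e: "e \<in> S" "u \<bullet> e \<noteq> 0"
      using inner_span_zero[OF u_in, of u] u_ne by (metis inner_eq_zero_iff)
    have "(\<Sum>e\<in>S. c e * (u \<bullet> e)\<^sup>2) < (\<Sum>e\<in>S. 0)"
    proof (rule sum_strict_mono_ex1[OF S(1)])
      show "\<forall>x\<in>S. c x * (u \<bullet> x)\<^sup>2 \<le> 0"
        using c by (auto simp: mult_le_0_iff intro: less_imp_le)
      show "\<exists>x\<in>S. c x * (u \<bullet> x)\<^sup>2 < 0"
        using e c by (intro bexI[of _ e]) (auto simp: mult_less_0_iff)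
    qed
    then show ?thesis using eq by simp
  qed
  have orth: "u \<bullet> e = 0" if "subspace N" "blinfun_apply T ` N \<subseteq> N"
      "\<And>u. u \<in> N \<Longrightarrow> u \<noteq> 0 \<Longrightarrow> 0 < T u \<bullet> u" "u \<in> N" "c < 0" "T e = c *\<^sub>R e" for N u e c
  proof (rule positive_invariant_orthogonal_negative_eigenvector[OF sa that(1,2) _ that(6,5,4)])
    fix w assume "w \<in> N"
    then show "0 \<le> T w \<bullet> w"
      using that(3)[of w] by (cases "w = 0") auto
  qed
  have "positive_subspace T = Z"
  proof
    show "Z \<subseteq> positive_subspace T"
      unfolding positive_subspace_def using Z Zc Zi Zpos by blast
    show "positive_subspace T \<subseteq> Z"
    proof
      fix u assume "u \<in> positive_subspace T"
      then obtain N where N: "subspace N" "blinfun_apply T ` N \<subseteq> N"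
        "\<And>u. u \<in> N \<Longrightarrow> u \<noteq> 0 \<Longrightarrow> 0 < T u \<bullet> u" "u \<in> N"
        unfolding positive_subspace_def by blast
      have "u \<bullet> e = 0" if eS: "e \<in> S" for e
      proof -
        obtain c where c: "c < 0" "T e = c *\<^sub>R e" using eig eS by blast
        show ?thesis by (rule orth[OF N(1,2) _ N(4) c]) (rule N(3))
      qed
      then show "u \<in> Z" by (simp add: Z_def)
    qed
  qed
  moreover have "negative_subspace T = span S"
  proof
    have "closed (span S)"
    proof -
      have "span S = {u. u - proj_span S u = 0}"
      proof (intro set_eqI iffI; clarsimp)
        fix u assume "u \<in> span S"
        then have "u - proj_span S u \<in> span S" using proj_span_in_span span_diff by blast
        then have "(u - proj_span S u) \<bullet> (u - proj_span S u) = 0"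
          by (rule residual_orthogonal_span[OF S])
        then show "u = proj_span S u" by simp
      next
        fix u assume "u = proj_span S u"
        then show "u \<in> span S" using proj_span_in_span by metis
      qed
      moreover have "closed {u. u - proj_span S u = 0}"
        by (intro closed_Collect_eq continuous_intros
            linear_continuous_on bounded_linear_proj_span)
      ultimately show ?thesis by simp
    qed
    moreover have "blinfun_apply T ` span S \<subseteq> span S"
    proof -
      have "T u \<in> span S" if "u \<in> span S" for u
        using that
      proof (induction rule: span_induct)
        case base
        then show ?case by (auto simp: subspace_def blinfun.add_right blinfun.scaleR_right
              span_add span_scale span_zero blinfun.zero_right)
      next
        case (step x)
        then show ?case using eig by (metis span_base span_scale)
      qed
      then show ?thesis by blast
    qed
    ultimately show "span S \<subseteq> negative_subspace T"
      unfolding negative_subspace_def using spanneg by (blast intro: subspace_span)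
    show "negative_subspace T \<subseteq> span S"
    proof
      fix u assume "u \<in> negative_subspace T"
      then obtain N where N: "subspace N" "closed N" "blinfun_apply T ` N \<subseteq> N"
        and neg: "\<And>u. u \<in> N \<Longrightarrow> u \<noteq> 0 \<Longrightarrow> T u \<bullet> u < 0" and u: "u \<in> N"
        unfolding negative_subspace_def by blast
      obtain S' where S': "S' \<subseteq> N" "finite S'" "orthonormal S'" "\<forall>e\<in>S'. \<exists>c<0. T e = c *\<^sub>R e"
        "\<And>u. u \<in> N \<Longrightarrow> (\<forall>e\<in>S'. u \<bullet> e = 0) \<Longrightarrow> 0 \<le> T u \<bullet> u"
        using finite_negative_eigenbasis[OF sa N split Q P] by blast
      \<comment> \<open>N is negative definite, so the complement of S' in N, where the form is nonnegative, is trivial.\<close>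
      define w where "w = u - proj_span S' u"
      have "proj_span S' u \<in> N"
        using proj_span_in_span[of S' u] span_minimal[OF S'(1) N(1)] by blast
      then have "w \<in> N" using u N(1) by (simp add: w_def subspace_diff)
      moreover have "w \<bullet> e = 0" if "e \<in> S'" for e
        using residual_orthogonal_span[OF S'(2,3) span_base[OF that]] by (simp add: w_def)
      ultimately have "w = 0" using neg S'(5) by force
      then have uS': "u \<in> span S'" using proj_span_in_span[of S' u] by (simp add: w_def)
      define z where "z = u - proj_span S u"
      have "z \<in> Z"
        unfolding Z_def z_def using residual_orthogonal_span[OF S] span_base by blast
      have "z \<bullet> e = 0" if eS: "e \<in> S'" for e
      proof -
        obtain c where c: "c < 0" "T e = c *\<^sub>R e" using S'(4) eS by blast
        show ?thesis by (rule orth[OF Z Zi _ \<open>z \<in> Z\<close> c]) (rule Zpos)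
      qed
      then have "z \<bullet> u = 0" by (rule inner_span_zero[OF uS'])
      moreover have "z \<bullet> proj_span S u = 0"
        unfolding z_def by (rule residual_orthogonal_span[OF S proj_span_in_span])
      ultimately have "z \<bullet> z = 0" by (simp add: z_def inner_diff_right)
      then show "u \<in> span S" using proj_span_in_span[of S u] by (simp add: z_def)
    qed
  qed
  ultimately show ?thesis using S eig unfolding Z_def by blast
qed

section \<open>Differentiability along a dense subspace\<close>

lemma has_dir_deriv_dir_deriv:
  assumes "continuously_dir_differentiable_on V f" "x \<in> V"
  shows "has_dir_deriv f x u (dir_deriv f x u)"
proof -
  obtain d where d: "has_dir_deriv f x u d"
    using assms unfolding continuously_dir_differentiable_on_def by blast
  then have "dir_deriv f x u = d"
    unfolding dir_deriv_def has_dir_deriv_def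
    by (intro the_equality) (auto intro: tendsto_unique[OF trivial_limit_at])
  with d show ?thesis by simp
qed

lemma has_dir_deriv_imp_real_derivative:
  fixes f :: "'a::real_normed_vector \<Rightarrow> real"
  assumes "has_dir_deriv f (x + t *\<^sub>R u) u d"
  shows "((\<lambda>s. f (x + s *\<^sub>R u)) has_real_derivative d) (at t)"
  using assms unfolding has_dir_deriv_def DERIV_def
  by (simp add: algebra_simps divide_inverse)

text \<open>
  On a segment in the range of \<open>j\<close> the derivative of \<open>L - q\<close> in the direction of the segment is the
  inner product of that direction with the error \<open>g x - T (j x)\<close> of the gradient, so the bound is the
  mean value theorem.
\<close>

lemma gradient_error_imp_lipschitz_dense:
  fixes j :: "'x::real_normed_vector \<Rightarrow> 'h::real_inner" and T :: "'h \<Rightarrow>\<^sub>L 'h"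
  assumes lin: "linear j" and sa: "self_adjoint T"
    and diff: "continuously_dir_differentiable_on V L"
    and grad: "\<And>x u. j x \<in> V \<Longrightarrow> dir_deriv L (j x) (j u) = g x \<bullet> j u"
    and err: "\<And>x. norm (j x) > \<rho> \<Longrightarrow> j x \<in> V \<and> norm (g x - T (j x)) \<le> \<epsilon> * norm (j x)"
    and eps: "\<epsilon> \<ge> 0"
    and seg: "\<And>z. z \<in> closed_segment (j x) (j y) \<Longrightarrow> norm z > \<rho>"
  shows "\<bar>(L (j y) - (T (j y) \<bullet> j y) / 2) - (L (j x) - (T (j x) \<bullet> j x) / 2)\<bar>
           \<le> \<epsilon> * max (norm (j x)) (norm (j y)) * norm (j y - j x)"
proof -
  define h where "h = y - x"
  define z where "z t = x + t *\<^sub>R h" for t :: real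
  have jz: "j (z t) = j x + t *\<^sub>R j h" for t
    using lin by (simp add: z_def linear_add linear_cmul)
  have jh: "j h = j y - j x" using lin by (simp add: h_def linear_diff)
  define G where "G w = L w - (T w \<bullet> w) / 2" for w
  have inseg: "j (z t) \<in> closed_segment (j x) (j y)" if "0 \<le> t" "t \<le> 1" for t
    unfolding in_segment jz jh using that by (intro exI[of _ t]) (simp add: algebra_simps)
  have der: "((\<lambda>s. G (j x + s *\<^sub>R j h)) has_real_derivative (g (z t) - T (j (z t))) \<bullet> j h) (at t)"
    if t: "0 \<le> t" "t \<le> 1" for t
  proof -
    have zV: "j (z t) \<in> V" using err seg inseg[OF t] by blast
    have "has_dir_deriv L (j (z t)) (j h) (g (z t) \<bullet> j h)"
      using has_dir_deriv_dir_deriv[OF diff zV, of "j h"] grad[OF zV] by simp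
    then have 1: "((\<lambda>s. L (j x + s *\<^sub>R j h)) has_real_derivative g (z t) \<bullet> j h) (at t)"
      unfolding jz by (rule has_dir_deriv_imp_real_derivative)
    have quad: "T (j x + s *\<^sub>R j h) \<bullet> (j x + s *\<^sub>R j h) / 2
        = (T (j x) \<bullet> j x) / 2 + s * (T (j x) \<bullet> j h) + s\<^sup>2 * (T (j h) \<bullet> j h) / 2" for s
    proof -
      have "T (j h) \<bullet> j x = T (j x) \<bullet> j h"
        using sa by (metis inner_commute self_adjoint_def)
      then show ?thesis
        by (simp add: blinfun.add_right blinfun.scaleR_right inner_add_left inner_add_right
            power2_eq_square field_simps)
    qed
    have 2: "((\<lambda>s. T (j x + s *\<^sub>R j h) \<bullet> (j x + s *\<^sub>R j h) / 2)
        has_real_derivative T (j (z t)) \<bullet> j h) (at t)"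
      unfolding quad jz
      by (auto intro!: derivative_eq_intros
          simp: blinfun.add_right blinfun.scaleR_right inner_add_left)
    show ?thesis
      unfolding G_def inner_diff_left by (rule DERIV_diff[OF 1 2])
  qed
  obtain t where t: "0 < t" "t < 1"
    and mvt: "G (j x + 1 *\<^sub>R j h) - G (j x + 0 *\<^sub>R j h) = (1 - 0) * ((g (z t) - T (j (z t))) \<bullet> j h)"
    using MVT2[of 0 1 "\<lambda>s. G (j x + s *\<^sub>R j h)" "\<lambda>t. (g (z t) - T (j (z t))) \<bullet> j h"] der by auto
  have "\<bar>G (j y) - G (j x)\<bar> = \<bar>(g (z t) - T (j (z t))) \<bullet> j h\<bar>"
    using mvt by (simp add: jh)
  also have "\<dots> \<le> norm (g (z t) - T (j (z t))) * norm (j h)" by (rule Cauchy_Schwarz_ineq2)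
  also have "\<dots> \<le> \<epsilon> * max (norm (j x)) (norm (j y)) * norm (j h)"
  proof (rule mult_right_mono)
    have "norm (j (z t)) \<le> max (norm (j x)) (norm (j y))"
    proof -
      have "j (z t) = (1 - t) *\<^sub>R j x + t *\<^sub>R j y" by (simp add: jz jh algebra_simps)
      also have "norm \<dots> \<le> (1 - t) * norm (j x) + t * norm (j y)"
        using t by (intro order_trans[OF norm_triangle_ineq]) simp
      also have "\<dots> \<le> max (norm (j x)) (norm (j y))"
        using t by (intro convex_bound_le) auto
      finally show ?thesis .
    qed
    moreover have "norm (g (z t) - T (j (z t))) \<le> \<epsilon> * norm (j (z t))"
      using err[OF seg[OF inseg[of t]]] t by simp
    ultimately show "norm (g (z t) - T (j (z t))) \<le> \<epsilon> * max (norm (j x)) (norm (j y))"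
      using eps by (meson mult_left_mono order_trans)
  qed simp
  finally show ?thesis by (simp add: G_def jh)
qed

text \<open>
  Only the endpoints need to be approximated from the range of \<open>j\<close>: by compactness the segment keeps
  a positive distance from the ball of radius \<open>\<rho>\<close>, so a segment with nearby endpoints avoids it too,
  and both sides of the inequality are continuous in the endpoints.
\<close>

lemma gradient_error_imp_lipschitz:
  fixes j :: "'x::real_normed_vector \<Rightarrow> 'h::real_inner" and T :: "'h \<Rightarrow>\<^sub>L 'h"
  assumes lin: "linear j" and sa: "self_adjoint T" and dense: "closure (range j) = UNIV"
    and diff: "continuously_dir_differentiable_on V L"
    and cont: "open V" "continuous_on V L"
    and grad: "\<And>x u. j x \<in> V \<Longrightarrow> dir_deriv L (j x) (j u) = g x \<bullet> j u"
    and far: "\<And>z. norm z > \<rho> \<Longrightarrow> z \<in> V"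
    and err: "\<And>x. norm (j x) > \<rho> \<Longrightarrow> norm (g x - T (j x)) \<le> \<epsilon> * norm (j x)"
    and eps: "\<epsilon> \<ge> 0"
    and seg: "\<And>z. z \<in> closed_segment x y \<Longrightarrow> norm z > \<rho>"
  shows "\<bar>(L y - (T y \<bullet> y) / 2) - (L x - (T x \<bullet> x) / 2)\<bar>
           \<le> \<epsilon> * max (norm x) (norm y) * norm (y - x)"
proof -
  obtain z0 where z0: "z0 \<in> closed_segment x y" "\<And>z. z \<in> closed_segment x y \<Longrightarrow> norm z0 \<le> norm z"
    using continuous_attains_inf[of "closed_segment x y" norm]
    by (auto intro: continuous_intros)
  define \<delta> where "\<delta> = norm z0 - \<rho>"
  have \<delta>: "\<delta> > 0" using seg[OF z0(1)] by (simp add: \<delta>_def)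
  have approx: "\<exists>u. (\<lambda>n. j (u n)) \<longlonglongrightarrow> w" for w
  proof -
    obtain f where f: "\<And>n. f n \<in> range j" "f \<longlonglongrightarrow> w"
      using dense closure_sequential[of w "range j"] by auto
    have "(\<lambda>n. j (inv j (f n))) = f"
      using f(1) by (simp add: f_inv_into_f)
    then show ?thesis using f(2) by (intro exI[of _ "\<lambda>n. inv j (f n)"]) simp
  qed
  obtain u v where u: "(\<lambda>n. j (u n)) \<longlonglongrightarrow> x" and v: "(\<lambda>n. j (v n)) \<longlonglongrightarrow> y"
    using approx[of x] approx[of y] by blast
  have Lx: "isCont L x" "isCont L y"
    using far seg cont by (auto simp: continuous_on_eq_continuous_at)
  show ?thesis
  proof (rule tendsto_le[OF sequentially_bot])
    show "(\<lambda>n. \<bar>(L (j (v n)) - (T (j (v n)) \<bullet> j (v n)) / 2) -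
        (L (j (u n)) - (T (j (u n)) \<bullet> j (u n)) / 2)\<bar>)
        \<longlonglongrightarrow> \<bar>(L y - (T y \<bullet> y) / 2) - (L x - (T x \<bullet> x) / 2)\<bar>"
      by (intro tendsto_intros u v isCont_tendsto_compose[OF Lx(1) u]
          isCont_tendsto_compose[OF Lx(2) v]) auto
    show "(\<lambda>n. \<epsilon> * max (norm (j (u n))) (norm (j (v n))) * norm (j (v n) - j (u n)))
        \<longlonglongrightarrow> \<epsilon> * max (norm x) (norm y) * norm (y - x)"
      by (intro tendsto_intros u v)
    have "\<forall>\<^sub>F n in sequentially. dist (j (u n)) x < \<delta>" "\<forall>\<^sub>F n in sequentially. dist (j (v n)) y < \<delta>"
      using u v \<delta> by (auto intro: tendstoD)
    then show "\<forall>\<^sub>F n in sequentially. \<bar>(L (j (v n)) - (T (j (v n)) \<bullet> j (v n)) / 2) -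
        (L (j (u n)) - (T (j (u n)) \<bullet> j (u n)) / 2)\<bar>
        \<le> \<epsilon> * max (norm (j (u n))) (norm (j (v n))) * norm (j (v n) - j (u n))"
    proof eventually_elim
      case (elim n)
      have "norm z > \<rho>" if zs: "z \<in> closed_segment (j (u n)) (j (v n))" for z
      proof -
        obtain t where t: "0 \<le> t" "t \<le> 1" "z = (1 - t) *\<^sub>R j (u n) + t *\<^sub>R j (v n)"
          using zs by (auto simp: in_segment)
        define w where "w = (1 - t) *\<^sub>R x + t *\<^sub>R y"
        have "w \<in> closed_segment x y" using t by (auto simp: in_segment w_def)
        then have "norm z0 \<le> norm w" by (rule z0)
        have "w - z = (1 - t) *\<^sub>R (x - j (u n)) + t *\<^sub>R (y - j (v n))"
          by (simp add: t w_def algebra_simps)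
        also have "norm \<dots> \<le> (1 - t) * norm (x - j (u n)) + t * norm (y - j (v n))"
          using t by (intro order_trans[OF norm_triangle_ineq]) simp
        also have "\<dots> < \<delta>"
          using t elim by (intro convex_bound_lt) (auto simp: dist_norm norm_minus_commute)
        finally have "norm (w - z) < \<delta>" .
        then show ?thesis
          using \<open>norm z0 \<le> norm w\<close> norm_triangle_ineq2[of w z] by (simp add: \<delta>_def)
      qed
      then show ?case
        by (intro gradient_error_imp_lipschitz_dense[OF lin sa diff grad _ eps])
          (use far err in auto)
    qed
  qed
qed

section \<open>Roots of monotone functions depending on a parameter\<close>

text \<open>
  By monotonicity the sign of \<open>F r x\<close> tells on which side of the root \<open>r\<close> lies. A strict sign at a fixed
  \<open>r\<close> persists for nearby \<open>x\<close>, so separate continuity of \<open>F\<close> suffices for continuity of the root.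
\<close>

lemma monotone_root_continuous:
  fixes F :: "real \<Rightarrow> 'a::topological_space \<Rightarrow> real"
  assumes mono: "\<And>x r s. x \<in> W \<Longrightarrow> lo \<le> r \<Longrightarrow> r < s \<Longrightarrow> s \<le> hi \<Longrightarrow> F r x < F s x"
    and cont_r: "\<And>x. x \<in> W \<Longrightarrow> continuous_on {lo..hi} (\<lambda>r. F r x)"
    and cont_x: "\<And>r. lo \<le> r \<Longrightarrow> r \<le> hi \<Longrightarrow> continuous_on W (F r)"
    and sign: "\<And>x. x \<in> W \<Longrightarrow> F lo x < 0" "\<And>x. x \<in> W \<Longrightarrow> 0 < F hi x"
    and "lo < hi"
  obtains g where "continuous_on W g" "\<And>x. x \<in> W \<Longrightarrow> lo < g x \<and> g x < hi"
    "\<And>x r. x \<in> W \<Longrightarrow> lo \<le> r \<Longrightarrow> r \<le> hi \<Longrightarrow> F r x = 0 \<longleftrightarrow> r = g x"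
proof -
  have "\<exists>r. lo \<le> r \<and> r \<le> hi \<and> F r x = 0" if "x \<in> W" for x
    using IVT'[of "\<lambda>r. F r x" lo 0 hi] that sign[OF that] cont_r \<open>lo < hi\<close> by auto
  then obtain g where g: "\<And>x. x \<in> W \<Longrightarrow> lo \<le> g x \<and> g x \<le> hi \<and> F (g x) x = 0" by metis
  have g': "lo < g x \<and> g x < hi" if "x \<in> W" for x
    using g[OF that] sign[OF that] by (metis order_le_less less_irrefl)
  have neg: "F r x < 0 \<longleftrightarrow> r < g x" if "x \<in> W" "lo \<le> r" "r \<le> hi" for x r
    using mono[of x r "g x"] mono[of x "g x" r] g[of x] that by (metis linorder_cases less_asym less_irrefl)
  have pos: "0 < F r x \<longleftrightarrow> g x < r" if "x \<in> W" "lo \<le> r" "r \<le> hi" for x r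
    using mono[of x r "g x"] mono[of x "g x" r] g[of x] that by (metis linorder_cases less_asym less_irrefl)
  have "continuous_on W g"
    unfolding continuous_on_def
  proof (intro ballI order_tendstoI)
    fix x r assume x: "x \<in> W" and r: "r < g x"
    define r' where "r' = max r lo"
    have r': "r' < g x" "lo \<le> r'" "r' \<le> hi" "r \<le> r'" using r g'[OF x] by (auto simp: r'_def)
    have "(F r' \<longlongrightarrow> F r' x) (at x within W)"
      using cont_x[OF r'(2,3)] x by (auto simp: continuous_on_def)
    then have "\<forall>\<^sub>F y in at x within W. F r' y < 0"
      by (rule order_tendstoD) (use neg[OF x r'(2,3)] r' in auto)
    moreover have "\<forall>\<^sub>F y in at x within W. y \<in> W" by (simp add: eventually_at_filter)
    ultimately show "\<forall>\<^sub>F y in at x within W. r < g y"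
      by eventually_elim (use neg r' in force)
  next
    fix x r assume x: "x \<in> W" and r: "g x < r"
    define r' where "r' = min r hi"
    have r': "g x < r'" "lo \<le> r'" "r' \<le> hi" "r' \<le> r" using r g'[OF x] by (auto simp: r'_def)
    have "(F r' \<longlongrightarrow> F r' x) (at x within W)"
      using cont_x[OF r'(2,3)] x by (auto simp: continuous_on_def)
    then have "\<forall>\<^sub>F y in at x within W. 0 < F r' y"
      by (rule order_tendstoD) (use pos[OF x r'(2,3)] r' in auto)
    moreover have "\<forall>\<^sub>F y in at x within W. y \<in> W" by (simp add: eventually_at_filter)
    ultimately show "\<forall>\<^sub>F y in at x within W. g y < r"
      by eventually_elim (use pos r' in force)
  qed
  moreover have "F r x = 0 \<longleftrightarrow> r = g x" if "x \<in> W" "lo \<le> r" "r \<le> hi" for x r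
    using neg[OF that] pos[OF that] g[OF that(1)] by (metis linorder_cases less_irrefl)
  ultimately show ?thesis using that[of g] g' by blast
qed

section \<open>Quadratic forms that are definite on two complementary subspaces\<close>

text \<open>
  Where \<open>f\<close> vanishes the factor may jump, as for the rescaling of a vector by a function of its
  direction; boundedness of the factor compensates for this.
\<close>

lemma continuous_scaleR_bounded:
  fixes f :: "'a::topological_space \<Rightarrow> 'b::real_normed_vector" and k :: "'a \<Rightarrow> real"
  assumes f: "continuous_on UNIV f" and bound: "\<And>x. \<bar>k x\<bar> \<le> C"
    and k: "\<And>x. f x \<noteq> 0 \<Longrightarrow> (k \<longlongrightarrow> k x) (at x)"
  shows "continuous_on UNIV (\<lambda>x. k x *\<^sub>R f x)"
  unfolding continuous_on_def
proof
  fix x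
  have fx: "(f \<longlongrightarrow> f x) (at x)" using f by (auto simp: continuous_on_def)
  show "((\<lambda>x. k x *\<^sub>R f x) \<longlongrightarrow> k x *\<^sub>R f x) (at x)"
  proof (cases "f x = 0")
    case True
    have "((\<lambda>y. k y *\<^sub>R f y) \<longlongrightarrow> 0) (at x)"
    proof (rule Lim_null_comparison)
      show "\<forall>\<^sub>F y in at x. norm (k y *\<^sub>R f y) \<le> C * norm (f y)"
        using bound by (auto intro!: always_eventually mult_right_mono)
      have "((\<lambda>y. C * norm (f y)) \<longlongrightarrow> C * norm (f x)) (at x)"
        by (intro tendsto_intros fx)
      then show "((\<lambda>y. C * norm (f y)) \<longlongrightarrow> 0) (at x)" using True by simp
    qed
    then show ?thesis using True by simp
  next
    case False
    then show ?thesis by (intro tendsto_scaleR k fx)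
  qed
qed

text \<open>
  The map \<open>p\<close> is the orthogonal projection to \<open>E\<close>, and \<open>F\<close> is the orthogonal complement of \<open>E\<close>.
\<close>

locale split_form =
  fixes T :: "'h::real_inner \<Rightarrow>\<^sub>L 'h" and E F :: "'h set" and p :: "'h \<Rightarrow> 'h" and a :: real
  assumes subspace_E: "subspace E" and subspace_F: "subspace F"
    and p_linear: "bounded_linear p"
    and p_in: "\<And>x. p x \<in> E" and m_in: "\<And>x. x - p x \<in> F"
    and orth: "\<And>u v. u \<in> E \<Longrightarrow> v \<in> F \<Longrightarrow> u \<bullet> v = 0"
    and T_orth: "\<And>u v. u \<in> E \<Longrightarrow> v \<in> F \<Longrightarrow> T u \<bullet> v = 0"
    and T_orth': "\<And>u v. u \<in> E \<Longrightarrow> v \<in> F \<Longrightarrow> T v \<bullet> u = 0"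
    and a_pos: "0 < a"
    and T_pos: "\<And>u. u \<in> E \<Longrightarrow> 2 * a * (norm u)\<^sup>2 \<le> T u \<bullet> u"
    and T_neg: "\<And>v. v \<in> F \<Longrightarrow> T v \<bullet> v \<le> - 2 * a * (norm v)\<^sup>2"
begin

definition m :: "'h \<Rightarrow> 'h" where "m x = x - p x"

definition q :: "'h \<Rightarrow> real" where "q x = (T x \<bullet> x) / 2"

text \<open>
  The orbits of \<open>r \<mapsto> flow r x\<close>, for \<open>r > 0\<close>, are the branches of hyperbolas on which
  \<open>\<parallel>p x\<parallel> \<parallel>m x\<parallel>\<close> and the directions of \<open>p x\<close> and \<open>m x\<close> are constant (rays, if one of the
  components vanishes).
\<close>

definition flow :: "real \<Rightarrow> 'h \<Rightarrow> 'h" where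
  "flow r x = r *\<^sub>R p x + inverse r *\<^sub>R m x"

text \<open>
  On \<open>E\<close> and on \<open>F\<close> this rescales each ray linearly, so that \<open>\<bar>q\<bar>\<close> of the image is the squared norm. It
  serves the purpose of the inverse square root of \<open>\<bar>T\<bar> / 2\<close>, but needs no functional calculus. At \<open>0\<close>
  the quotient is \<open>0\<close>, which is harmless because it multiplies the zero vector.
\<close>

definition stretch :: "'h \<Rightarrow> 'h" where "stretch u = (norm u / sqrt \<bar>q u\<bar>) *\<^sub>R u"

definition unstretch :: "'h \<Rightarrow> 'h" where "unstretch u = (sqrt \<bar>q u\<bar> / norm u) *\<^sub>R u"

lemma m_in_F: "m x \<in> F" by (simp add: m_def m_in)

lemma decompose: "p x + m x = x" by (simp add: m_def)

lemma p_add [simp]: "p (x + y) = p x + p y"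
  and p_scale [simp]: "p (c *\<^sub>R x) = c *\<^sub>R p x"
  using p_linear by (auto simp: bounded_linear.linear linear_add linear_cmul)

lemma p_E [simp]: "u \<in> E \<Longrightarrow> p u = u"
proof -
  assume u: "u \<in> E"
  have "u - p u \<in> E" "u - p u \<in> F" using u p_in m_in subspace_E by (auto intro: subspace_diff)
  then have "(u - p u) \<bullet> (u - p u) = 0" by (rule orth)
  then show "p u = u" by simp
qed

lemma p_F [simp]: "v \<in> F \<Longrightarrow> p v = 0"
proof -
  assume v: "v \<in> F"
  have "v - (v - p v) \<in> F" using v m_in subspace_F by (blast intro: subspace_diff)
  then have "p v \<in> F" by simp
  then have "p v \<bullet> p v = 0" by (rule orth[OF p_in])
  then show "p v = 0" by simp
qed

lemma p_p [simp]: "p (p x) = p x" and p_m [simp]: "p (m x) = 0"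
  by (simp_all add: p_in m_in_F)

lemma m_add [simp]: "m (x + y) = m x + m y"
  and m_scale [simp]: "m (c *\<^sub>R x) = c *\<^sub>R m x"
  and m_p [simp]: "m (p x) = 0" and m_m [simp]: "m (m x) = m x"
  using p_m[of x] by (simp_all add: m_def algebra_simps)

lemma continuous_on_p [continuous_intros]:
  "continuous_on S f \<Longrightarrow> continuous_on S (\<lambda>x. p (f x))"
  by (rule bounded_linear.continuous_on[OF p_linear])

lemma continuous_on_m [continuous_intros]:
  "continuous_on S f \<Longrightarrow> continuous_on S (\<lambda>x. m (f x))"
  unfolding m_def by (intro continuous_intros)

lemma continuous_on_q [continuous_intros]:
  "continuous_on S f \<Longrightarrow> continuous_on S (\<lambda>x. q (f x))"
  unfolding q_def by (intro continuous_intros) auto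

lemma norm_split: "(norm x)\<^sup>2 = (norm (p x))\<^sup>2 + (norm (m x))\<^sup>2"
proof -
  have "(norm (p x + m x))\<^sup>2 = (norm (p x))\<^sup>2 + (norm (m x))\<^sup>2"
    using orth[OF p_in m_in_F, of x x] unfolding power2_norm_eq_inner
    by (simp add: inner_add_left inner_add_right inner_commute)
  then show ?thesis by (simp add: decompose)
qed

lemma norm_p_le: "norm (p x) \<le> norm x"
  by (rule power2_le_imp_le) (use norm_split[of x] in auto)

lemma q_scale: "q (c *\<^sub>R x) = c\<^sup>2 * q x"
  by (simp add: q_def blinfun.scaleR_right power2_eq_square)

lemma q_split: "q x = q (p x) + q (m x)"
proof -
  have "q (p x + m x) = q (p x) + q (m x)"
    using T_orth[OF p_in m_in_F, of x x] T_orth'[OF p_in m_in_F, of x x]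
    by (simp add: q_def blinfun.add_right inner_add_left inner_add_right add_divide_distrib)
  then show ?thesis by (simp add: decompose)
qed

lemma q_E: "u \<in> E \<Longrightarrow> a * (norm u)\<^sup>2 \<le> q u"
  using T_pos[of u] by (simp add: q_def)

lemma q_F: "v \<in> F \<Longrightarrow> a * (norm v)\<^sup>2 \<le> - q v"
  using T_neg[of v] by (simp add: q_def)

lemma q_definite: "u \<in> E \<union> F \<Longrightarrow> a * (norm u)\<^sup>2 \<le> \<bar>q u\<bar>"
  using q_E[of u] q_F[of u] by auto

lemma q_bounded: "\<bar>q u\<bar> \<le> norm T / 2 * (norm u)\<^sup>2"
proof -
  have "\<bar>T u \<bullet> u\<bar> \<le> norm (T u) * norm u" by (rule Cauchy_Schwarz_ineq2)
  also have "\<dots> \<le> norm T * norm u * norm u" by (intro mult_right_mono norm_blinfun) auto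
  finally show ?thesis by (simp add: q_def power2_eq_square)
qed

lemma p_flow [simp]: "p (flow r x) = r *\<^sub>R p x"
  and m_flow [simp]: "m (flow r x) = inverse r *\<^sub>R m x"
  by (simp_all add: flow_def)

lemma flow_inverse: "r \<noteq> 0 \<Longrightarrow> flow (inverse r) (flow r x) = x"
  by (simp add: flow_def decompose)

lemma q_flow: "q (flow r x) = r\<^sup>2 * q (p x) + (inverse r)\<^sup>2 * q (m x)"
  by (subst q_split) (simp add: q_scale)

text \<open>
  Between two points of one hyperbola the distance is at most of order \<open>(s - r) n\<close>, while \<open>q\<close> grows at
  least by order \<open>(s - r) n\<^sup>2\<close>. This mismatch lets \<open>q\<close> win against a perturbation with a small
  Lipschitz constant relative to the norm. Both contributions to the growth are positive: the flow
  expands \<open>E\<close>, where \<open>q\<close> is positive, and contracts \<open>F\<close>, where \<open>q\<close> is negative.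
\<close>

lemma flow_estimates:
  fixes r s :: real and x :: 'h
  assumes "3/4 \<le> r" "r < s" "s \<le> 4/3"
  defines "n \<equiv> norm (p x) + norm (m x)"
  shows "norm (flow r x) \<le> 4/3 * n" "norm (flow s x) \<le> 4/3 * n"
    and "norm (flow s x - flow r x) \<le> 16/9 * (s - r) * n"
    and "27/64 * (s - r) * (a * n\<^sup>2) \<le> q (flow s x) - q (flow r x)"
proof -
  define r' s' where "r' = inverse r" and "s' = inverse s"
  have inv: "3/4 \<le> r'" "r' \<le> 4/3" "3/4 \<le> s'" "s' \<le> 4/3"
    using assms(1-3) by (auto simp: r'_def s'_def field_simps)
  have prod: "r' * s' \<le> 16/9" "9/16 \<le> r' * s'"
    using mult_mono[of r' "4/3" s' "4/3"] mult_mono[of "3/4" r' "3/4" s'] inv by auto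
  have diff: "r' - s' = (s - r) * (r' * s')"
    using assms(1-3) by (simp add: r'_def s'_def field_simps)
  then have diff_ge: "9/16 * (s - r) \<le> r' - s'" and diff_le: "r' - s' \<le> 16/9 * (s - r)"
    using prod assms(1-3) mult_left_mono[of "9/16" "r' * s'" "s - r"]
      mult_left_mono[of "r' * s'" "16/9" "s - r"] by (auto simp: mult_ac)
  have diff0: "0 \<le> r' - s'" by (rule order_trans[OF _ diff_ge]) (use assms(2) in simp)
  have bound: "norm (flow t x) \<le> 4/3 * n" if "0 \<le> t" "t \<le> 4/3" "inverse t \<le> 4/3" for t
  proof -
    have "norm (flow t x) \<le> t * norm (p x) + inverse t * norm (m x)"
      unfolding flow_def using that by (intro order_trans[OF norm_triangle_ineq]) simp
    also have "\<dots> \<le> 4/3 * norm (p x) + 4/3 * norm (m x)"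
      using that by (intro add_mono mult_right_mono) auto
    finally show ?thesis by (simp add: n_def)
  qed
  show "norm (flow r x) \<le> 4/3 * n" "norm (flow s x) \<le> 4/3 * n"
    by (rule bound; use assms(1-3) inv in \<open>simp add: r'_def s'_def\<close>)+
  have "flow s x - flow r x = (s - r) *\<^sub>R p x - (r' - s') *\<^sub>R m x"
    by (simp add: flow_def r'_def s'_def algebra_simps)
  also have "norm \<dots> \<le> (s - r) * norm (p x) + (r' - s') * norm (m x)"
    using assms(1-3) diff0 by (intro order_trans[OF norm_triangle_ineq4]) simp
  also have "\<dots> \<le> 16/9 * (s - r) * norm (p x) + 16/9 * (s - r) * norm (m x)"
    using assms(1-3) diff_le by (intro add_mono mult_right_mono) auto
  also have "\<dots> = 16/9 * (s - r) * n" unfolding n_def by (rule distrib_left[symmetric])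
  finally show "norm (flow s x - flow r x) \<le> 16/9 * (s - r) * n" .
  have "n\<^sup>2 \<le> 2 * ((norm (p x))\<^sup>2 + (norm (m x))\<^sup>2)"
    using sum_squares_bound[of "norm (p x)" "norm (m x)"]
    by (simp add: n_def power2_sum)
  then have "27/64 * (s - r) * (a * n\<^sup>2)
      \<le> 27/64 * (s - r) * (a * (2 * ((norm (p x))\<^sup>2 + (norm (m x))\<^sup>2)))"
    using assms(1-3) a_pos by (intro mult_left_mono) auto
  also have "\<dots> = 27/32 * (s - r) * (a * (norm (p x))\<^sup>2) + 27/32 * (s - r) * (a * (norm (m x))\<^sup>2)"
    by (simp add: field_simps)
  also have "\<dots> \<le> (s\<^sup>2 - r\<^sup>2) * q (p x) + (r'\<^sup>2 - s'\<^sup>2) * - q (m x)"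
  proof (intro add_mono mult_mono q_E p_in q_F m_in_F)
    have "27/32 * (s - r) \<le> (s + r) * (s - r)"
      using assms(1-3) by (intro mult_right_mono) auto
    then show "27/32 * (s - r) \<le> s\<^sup>2 - r\<^sup>2" by (simp add: power2_eq_square algebra_simps)
    have "27/32 * (s - r) = 3/2 * (9/16 * (s - r))" by simp
    also have "\<dots> \<le> 3/2 * (r' - s')" using diff_ge by (rule mult_left_mono) simp
    also have "\<dots> \<le> (r' + s') * (r' - s')"
      using inv diff0 by (intro mult_right_mono) auto
    finally show "27/32 * (s - r) \<le> r'\<^sup>2 - s'\<^sup>2" by (simp add: power2_eq_square algebra_simps)
    show "0 \<le> s\<^sup>2 - r\<^sup>2" using assms(1-3) by (simp add: power_mono)
    show "0 \<le> r'\<^sup>2 - s'\<^sup>2" using inv diff0 by (simp add: power_mono)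
  qed (use a_pos in auto)
  also have "\<dots> = q (flow s x) - q (flow r x)"
    by (simp add: q_flow r'_def s'_def algebra_simps)
  finally show "27/64 * (s - r) * (a * n\<^sup>2) \<le> q (flow s x) - q (flow r x)" .
qed

lemma q_flow_strict_mono:
  assumes "3/4 \<le> r" "r < s" "s \<le> 4/3" "x \<noteq> 0"
  shows "q (flow r x) < q (flow s x)"
proof -
  have "norm (p x) + norm (m x) \<noteq> 0"
    using assms(4) decompose[of x] by (auto simp: add_nonneg_eq_0_iff)
  then have "0 < 27/64 * (s - r) * (a * (norm (p x) + norm (m x))\<^sup>2)"
    using assms a_pos by simp
  then show ?thesis
    using flow_estimates(4)[OF assms(1-3), of x] by linarith
qed

lemma q_flow_ends:
  "7/16 * (a * (norm x)\<^sup>2) \<le> q (flow (4/3) x) - q x"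
  "7/16 * (a * (norm x)\<^sup>2) \<le> q x - q (flow (3/4) x)"
proof -
  have "a * (norm x)\<^sup>2 = a * (norm (p x))\<^sup>2 + a * (norm (m x))\<^sup>2"
    by (simp add: norm_split[of x] algebra_simps)
  moreover have "q (flow (4/3) x) - q x = 7/9 * q (p x) + 7/16 * - q (m x)"
    "q x - q (flow (3/4) x) = 7/16 * q (p x) + 7/9 * - q (m x)"
    by (simp_all add: q_flow q_split[of x] power2_eq_square)
  moreover have "0 \<le> a * (norm (p x))\<^sup>2" "0 \<le> a * (norm (m x))\<^sup>2"
    using a_pos by simp_all
  ultimately show "7/16 * (a * (norm x)\<^sup>2) \<le> q (flow (4/3) x) - q x"
    "7/16 * (a * (norm x)\<^sup>2) \<le> q x - q (flow (3/4) x)"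
    using q_E[OF p_in, of x] q_F[OF m_in_F, of x] by linarith+
qed

lemma continuous_on_flow [continuous_intros]:
  "continuous_on S f \<Longrightarrow> continuous_on S g \<Longrightarrow> (\<And>x. x \<in> S \<Longrightarrow> f x \<noteq> 0) \<Longrightarrow>
    continuous_on S (\<lambda>x. flow (f x) (g x))"
  unfolding flow_def by (intro continuous_intros) auto

section \<open>Rescaling the rays of the two subspaces\<close>

lemma sqrt_q_bounds:
  assumes "u \<in> E \<union> F"
  shows "sqrt a * norm u \<le> sqrt \<bar>q u\<bar>" "sqrt \<bar>q u\<bar> \<le> sqrt (norm T / 2) * norm u"
proof -
  have "sqrt (a * (norm u)\<^sup>2) \<le> sqrt \<bar>q u\<bar>"
    using q_definite[OF assms] by (simp only: real_sqrt_le_iff)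
  then show "sqrt a * norm u \<le> sqrt \<bar>q u\<bar>" by (simp add: real_sqrt_mult)
  have "sqrt \<bar>q u\<bar> \<le> sqrt (norm T / 2 * (norm u)\<^sup>2)"
    using q_bounded[of u] by (simp only: real_sqrt_le_iff)
  then show "sqrt \<bar>q u\<bar> \<le> sqrt (norm T / 2) * norm u" by (simp only: real_sqrt_mult real_sqrt_abs abs_norm_cancel)
qed

lemma q_nonzero:
  assumes "u \<in> E \<union> F" "u \<noteq> 0"
  shows "q u \<noteq> 0"
proof -
  have "0 < a * (norm u)\<^sup>2" using assms(2) a_pos by simp
  then show ?thesis using q_definite[OF assms(1)] by auto
qed

lemma stretch_in: "u \<in> E \<Longrightarrow> stretch u \<in> E" "u \<in> F \<Longrightarrow> stretch u \<in> F"
  and unstretch_in: "u \<in> E \<Longrightarrow> unstretch u \<in> E" "u \<in> F \<Longrightarrow> unstretch u \<in> F"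
  by (simp_all add: stretch_def unstretch_def subspace_scale subspace_E subspace_F)

lemma sqrt_q_scale: "0 \<le> k \<Longrightarrow> sqrt \<bar>q (k *\<^sub>R u)\<bar> = k * sqrt \<bar>q u\<bar>"
  by (simp add: q_scale abs_mult real_sqrt_mult)

lemma unstretch_stretch:
  assumes "u \<in> E \<union> F"
  shows "unstretch (stretch u) = u"
proof (cases "u = 0")
  case False
  then show ?thesis
    using q_nonzero[OF assms] sqrt_q_scale[of "norm u / sqrt \<bar>q u\<bar>" u]
    by (simp add: stretch_def unstretch_def)
qed (simp add: stretch_def unstretch_def)

lemma stretch_unstretch:
  assumes "u \<in> E \<union> F"
  shows "stretch (unstretch u) = u"
proof (cases "u = 0")
  case False
  then show ?thesis
    using q_nonzero[OF assms] sqrt_q_scale[of "sqrt \<bar>q u\<bar> / norm u" u]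
    by (simp add: stretch_def unstretch_def)
qed (simp add: stretch_def unstretch_def)

lemma q_0 [simp]: "q 0 = 0" by (simp add: q_def)

lemma q_stretch: "u \<in> E \<Longrightarrow> q (stretch u) = (norm u)\<^sup>2" "u \<in> F \<Longrightarrow> q (stretch u) = - (norm u)\<^sup>2"
proof -
  assume u: "u \<in> E"
  then have "0 \<le> q u" using q_E[OF u] a_pos by (meson less_imp_le mult_nonneg_nonneg order_trans zero_le_power2)
  then show "q (stretch u) = (norm u)\<^sup>2"
    using q_nonzero[of u] u by (cases "u = 0") (simp_all add: stretch_def q_scale power_divide)
next
  assume u: "u \<in> F"
  then have "0 \<le> - q u" using q_F[OF u] a_pos by (meson less_imp_le mult_nonneg_nonneg order_trans zero_le_power2)
  then show "q (stretch u) = - (norm u)\<^sup>2"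
    using q_nonzero[of u] u by (cases "u = 0") (simp_all add: stretch_def q_scale power_divide)
qed

lemma norm_stretch:
  assumes "u \<in> E \<union> F"
  shows "norm u / sqrt (norm T / 2) \<le> norm (stretch u)" "norm (stretch u) \<le> norm u / sqrt a"
proof -
  have eq: "norm (stretch u) = norm u * (norm u / sqrt \<bar>q u\<bar>)" by (simp add: stretch_def)
  have "norm u / sqrt (norm T / 2) \<le> norm (stretch u) \<and> norm (stretch u) \<le> norm u / sqrt a"
  proof (cases "u = 0")
    case False
    then have s: "0 < sqrt \<bar>q u\<bar>" using q_nonzero[OF assms] by simp
    then have N: "0 < sqrt (norm T / 2)"
      using sqrt_q_bounds(2)[OF assms] False by (smt (verit) mult_nonpos_nonneg norm_ge_zero)
    have "1 / sqrt (norm T / 2) \<le> norm u / sqrt \<bar>q u\<bar>"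
      using sqrt_q_bounds(2)[OF assms] s N 
      by (metis (no_types) divide_le_eq le_divide_eq mult.commute mult_1 times_divide_eq_right)
    moreover have "norm u / sqrt \<bar>q u\<bar> \<le> 1 / sqrt a"
      using sqrt_q_bounds(1)[OF assms] s a_pos by (simp add: field_simps)
    ultimately show ?thesis
      unfolding eq using mult_left_mono[of _ _ "norm u"] by (metis mult.right_neutral norm_ge_zero times_divide_eq_right)
  qed (simp add: stretch_def)
  then show "norm u / sqrt (norm T / 2) \<le> norm (stretch u)" "norm (stretch u) \<le> norm u / sqrt a"
    by auto
qed

lemma continuous_stretch:
  assumes f: "continuous_on UNIV f" and f_in: "\<And>x. f x \<in> E \<union> F"
  shows "continuous_on UNIV (\<lambda>x. stretch (f x))" "continuous_on UNIV (\<lambda>x. unstretch (f x))"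
proof -
  have lim: "(f \<longlongrightarrow> f x) (at x)" "((\<lambda>x. q (f x)) \<longlongrightarrow> q (f x)) (at x)" for x
    using f continuous_on_q[OF f] by (auto simp: continuous_on_def)
  show "continuous_on UNIV (\<lambda>x. stretch (f x))"
    unfolding stretch_def
  proof (rule continuous_scaleR_bounded[OF f, where C = "1 / sqrt a"])
    fix x
    show "\<bar>norm (f x) / sqrt \<bar>q (f x)\<bar>\<bar> \<le> 1 / sqrt a"
    proof (cases "f x = 0")
      case False
      then show ?thesis
        using sqrt_q_bounds(1)[OF f_in[of x]] q_nonzero[OF f_in] a_pos
        by (simp add: divide_simps mult_ac)
    qed (use a_pos in simp)
    assume "f x \<noteq> 0"
    then have "sqrt \<bar>q (f x)\<bar> \<noteq> 0" using q_nonzero[OF f_in] by simp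
    then show "((\<lambda>x. norm (f x) / sqrt \<bar>q (f x)\<bar>) \<longlongrightarrow> norm (f x) / sqrt \<bar>q (f x)\<bar>) (at x)"
      by (intro tendsto_intros lim)
  qed
  show "continuous_on UNIV (\<lambda>x. unstretch (f x))"
    unfolding unstretch_def
  proof (rule continuous_scaleR_bounded[OF f, where C = "sqrt (norm T / 2)"])
    fix x
    show "\<bar>sqrt \<bar>q (f x)\<bar> / norm (f x)\<bar> \<le> sqrt (norm T / 2)"
    proof (cases "f x = 0")
      case False
      then show ?thesis
        using sqrt_q_bounds(2)[OF f_in[of x]] by (simp add: pos_divide_le_eq)
    qed simp
    assume "f x \<noteq> 0"
    then have "norm (f x) \<noteq> 0" by simp
    then show "((\<lambda>x. sqrt \<bar>q (f x)\<bar> / norm (f x)) \<longlongrightarrow> sqrt \<bar>q (f x)\<bar> / norm (f x)) (at x)"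
      by (intro tendsto_intros lim)
  qed
qed

definition stretch2 :: "'h \<Rightarrow> 'h" where "stretch2 x = stretch (p x) + stretch (m x)"

definition unstretch2 :: "'h \<Rightarrow> 'h" where "unstretch2 x = unstretch (p x) + unstretch (m x)"

lemma stretch2_components [simp]:
  "p (stretch2 x) = stretch (p x)" "m (stretch2 x) = stretch (m x)"
  using stretch_in(1)[OF p_in] stretch_in(2)[OF m_in_F]
  by (simp_all add: stretch2_def m_def[of "stretch _"])

lemma unstretch2_components [simp]:
  "p (unstretch2 x) = unstretch (p x)" "m (unstretch2 x) = unstretch (m x)"
  using unstretch_in(1)[OF p_in] unstretch_in(2)[OF m_in_F]
  by (simp_all add: unstretch2_def m_def[of "unstretch _"])

lemma unstretch2_stretch2: "unstretch2 (stretch2 x) = x"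
  and stretch2_unstretch2: "stretch2 (unstretch2 x) = x"
  using p_in m_in_F
  by (simp_all add: unstretch2_def[of "stretch2 x"] stretch2_def[of "unstretch2 x"]
      unstretch_stretch stretch_unstretch decompose)

lemma continuous_stretch2: "continuous_on UNIV stretch2" "continuous_on UNIV unstretch2"
  unfolding stretch2_def[abs_def] unstretch2_def[abs_def]
  by (intro continuous_on_add continuous_stretch continuous_intros; use p_in m_in_F in blast)+

lemma q_stretch2: "q (stretch2 x) = (norm (p x))\<^sup>2 - (norm (m x))\<^sup>2"
  by (simp add: q_split[of "stretch2 x"] q_stretch p_in m_in_F)

end

section \<open>Straightening a perturbed saddle form\<close>

text \<open>
  The factor \<open>1/20\<close> is small enough for the flow parameters between \<open>3/4\<close> and \<open>4/3\<close>: by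
  \<open>flow_estimates\<close> monotonicity of \<open>L\<close> needs \<open>4/3 * 16/9 / 20 < 27/64\<close>, and by \<open>q_flow_ends\<close> the bracketing
  of the roots needs \<open>16/9 / 20 < 7/16\<close>.
\<close>

locale asymptotic_saddle = split_form T E F p a
  for T :: "'h::real_inner \<Rightarrow>\<^sub>L 'h" and E F p a +
  fixes V :: "'h set" and L :: "'h \<Rightarrow> real" and \<rho> :: real
  assumes rho_pos: "0 < \<rho>"
    and far: "\<And>z. \<rho> < norm z \<Longrightarrow> z \<in> V"
    and L_cont: "continuous_on V L"
    and L_close: "\<And>z. \<rho> < norm z \<Longrightarrow> \<bar>L z - (T z \<bullet> z) / 2\<bar> \<le> a / 20 * (norm z)\<^sup>2"
    and L_lipschitz: "\<And>x y. (\<And>z. z \<in> closed_segment x y \<Longrightarrow> \<rho> < norm z) \<Longrightarrow>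
      \<bar>(L y - (T y \<bullet> y) / 2) - (L x - (T x \<bullet> x) / 2)\<bar>
        \<le> a / 20 * max (norm x) (norm y) * norm (y - x)"
begin

lemma flow_far:
  assumes "4/3 * \<rho> < norm (p x)" "3/4 \<le> r"
  shows "\<rho> < norm (p (flow r x))" "\<rho> < norm (flow r x)"
proof -
  have "3/4 * norm (p x) \<le> r * norm (p x)" using assms(2) by (intro mult_right_mono) auto
  then show "\<rho> < norm (p (flow r x))" using assms by simp
  then show "\<rho> < norm (flow r x)" using norm_p_le[of "flow r x"] by linarith
qed

text \<open>
  The chord between two points of a hyperbola stays far from the origin because its projection to \<open>E\<close>
  is a multiple of \<open>p x\<close> by a factor of at least \<open>3/4\<close>. So the Lipschitz bound applies to it, and it
  is dominated by the growth of \<open>q\<close>.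
\<close>

lemma L_flow_strict_mono:
  assumes x: "4/3 * \<rho> < norm (p x)" and rs: "3/4 \<le> r" "r < s" "s \<le> 4/3"
  shows "L (flow r x) < L (flow s x)"
proof -
  define n where "n = norm (p x) + norm (m x)"
  have n: "0 < n" unfolding n_def using x rho_pos by (intro add_pos_nonneg) auto
  have seg: "\<rho> < norm z" if z: "z \<in> closed_segment (flow r x) (flow s x)" for z
  proof -
    obtain t where t: "0 \<le> t" "t \<le> 1" "z = (1 - t) *\<^sub>R flow r x + t *\<^sub>R flow s x"
      using z by (auto simp: in_segment)
    have pz: "p z = ((1 - t) * r + t * s) *\<^sub>R p x" by (simp add: t(3) scaleR_add_left)
    have "(1 - t) * (3/4) + t * (3/4) \<le> (1 - t) * r + t * s"
      using t rs by (intro add_mono mult_left_mono) auto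
    moreover have "(1 - t) * (3/4) + t * (3/4) = 3/4"
      by (simp only: distrib_right[symmetric]) simp
    ultimately have "3/4 \<le> (1 - t) * r + t * s" by (simp only:)
    then have "3/4 \<le> \<bar>(1 - t) * r + t * s\<bar>" by (rule order_trans) simp
    then have "3/4 * norm (p x) \<le> \<bar>(1 - t) * r + t * s\<bar> * norm (p x)"
      by (rule mult_right_mono) simp
    then have "3/4 * norm (p x) \<le> norm (p z)" by (simp only: pz norm_scaleR)
    then show ?thesis using x norm_p_le[of z] by linarith
  qed
  have "\<bar>(L (flow s x) - q (flow s x)) - (L (flow r x) - q (flow r x))\<bar>
      \<le> a / 20 * max (norm (flow r x)) (norm (flow s x)) * norm (flow s x - flow r x)"
    using L_lipschitz[OF seg] by (simp add: q_def)
  also have "\<dots> \<le> a / 20 * (4/3 * n) * (16/9 * (s - r) * n)"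
    using flow_estimates(1-3)[OF rs, of x] a_pos n rs
    by (intro mult_mono) (auto simp: n_def[symmetric] le_max_iff_disj)
  also have "\<dots> = 16/135 * ((s - r) * (a * n\<^sup>2))" by (simp add: power2_eq_square)
  also have "\<dots> < 27/64 * ((s - r) * (a * n\<^sup>2))"
    using a_pos n rs by (intro mult_strict_right_mono mult_pos_pos) auto
  also have "\<dots> \<le> q (flow s x) - q (flow r x)"
    using flow_estimates(4)[OF rs, of x] by (simp only: n_def mult.assoc)
  finally show ?thesis by linarith
qed

lemma flow_ends_separate:
  assumes "\<rho> < norm x"
  shows "q (flow (3/4) x) < L x" "L x < q (flow (4/3) x)"
proof -
  have "0 < a * (norm x)\<^sup>2"
    using assms rho_pos a_pos by (intro mult_pos_pos zero_less_power) auto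
  then show "q (flow (3/4) x) < L x" "L x < q (flow (4/3) x)"
    using q_flow_ends[of x] L_close[OF assms, folded q_def] by (simp_all only: abs_le_iff) linarith+
qed

lemma L_flow_ends:
  assumes x: "4/3 * \<rho> < norm (p x)"
  shows "L (flow (3/4) x) < q x" "q x < L (flow (4/3) x)"
proof -
  have pos: "0 < a * (norm x)\<^sup>2"
    using x norm_p_le[of x] rho_pos a_pos by (intro mult_pos_pos zero_less_power) auto
  have "a / 20 * (norm (flow r x))\<^sup>2 < 7/16 * (a * (norm x)\<^sup>2)" if r: "3/4 \<le> r" "r \<le> 4/3" for r
  proof -
    have i: "0 \<le> inverse r" "inverse r \<le> 4/3" using r by (auto simp: field_simps)
    have "(norm (flow r x))\<^sup>2 = r\<^sup>2 * (norm (p x))\<^sup>2 + (inverse r)\<^sup>2 * (norm (m x))\<^sup>2"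
      by (simp add: norm_split[of "flow r x"] power_mult_distrib power_inverse)
    also have "\<dots> \<le> (4/3)\<^sup>2 * (norm (p x))\<^sup>2 + (4/3)\<^sup>2 * (norm (m x))\<^sup>2"
      using r i by (intro add_mono mult_right_mono power_mono) auto
    also have "\<dots> = 16/9 * (norm x)\<^sup>2"
      by (simp add: norm_split[of x] power_divide distrib_left)
    finally have "a / 20 * (norm (flow r x))\<^sup>2 \<le> a / 20 * (16/9 * (norm x)\<^sup>2)"
      using a_pos by (intro mult_left_mono) auto
    also have "\<dots> = 4/45 * (a * (norm x)\<^sup>2)" by simp
    also have "\<dots> < 7/16 * (a * (norm x)\<^sup>2)" using pos by simp
    finally show ?thesis .
  qed
  from this[of "3/4"] this[of "4/3"] show "L (flow (3/4) x) < q x" "q x < L (flow (4/3) x)"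
    using q_flow_ends[of x] L_close[OF flow_far(2)[OF x, of "3/4"], folded q_def]
      L_close[OF flow_far(2)[OF x, of "4/3"], folded q_def]
    by (simp_all only: abs_le_iff) linarith+
qed

text \<open>
  The map \<open>\<Phi>\<close> slides \<open>x\<close> along its hyperbola to the point where \<open>L\<close> takes the value \<open>q x\<close>, and \<open>\<Psi>\<close> slides
  \<open>y\<close> to the point where \<open>q\<close> takes the value \<open>L y\<close>. As both stay on the hyperbola, and as the interval of
  parameters is closed under inversion, uniqueness of the roots makes them inverse to each other.
  The domain of \<open>\<Phi>\<close> is smaller than that of \<open>\<Psi>\<close> so that the flow with parameter \<open>3/4\<close> does not
  leave the region where \<open>L\<close> is controlled.
\<close>

lemma straightening:
  obtains \<Phi> \<Psi> where
    "continuous_on {x. 4/3 * \<rho> < norm (p x)} \<Phi>" "continuous_on {y. \<rho> < norm (p y)} \<Psi>"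
    "\<And>x. 4/3 * \<rho> < norm (p x) \<Longrightarrow> L (\<Phi> x) = q x \<and> \<Psi> (\<Phi> x) = x \<and>
        3/4 * norm (p x) \<le> norm (p (\<Phi> x)) \<and> norm (p (\<Phi> x)) \<le> 4/3 * norm (p x)"
    "\<And>y. 4/3 * \<rho> < norm (p (\<Psi> y)) \<Longrightarrow> \<rho> < norm (p y) \<Longrightarrow> \<Phi> (\<Psi> y) = y"
    "\<And>y. \<rho> < norm (p y) \<Longrightarrow> 3/4 * norm (p y) \<le> norm (p (\<Psi> y))"
proof -
  define W1 where "W1 = {x. 4/3 * \<rho> < norm (p x)}"
  define W2 where "W2 = {y. \<rho> < norm (p y)}"
  have W2_far: "\<rho> < norm y" if "y \<in> W2" for y
    using that norm_p_le[of y] by (simp add: W2_def)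
  have flow_W2: "flow r x \<in> W2" if "x \<in> W1" "3/4 \<le> r" for r x
    using that flow_far(1) by (simp add: W1_def W2_def)
  have L_cont_W2: "continuous_on W2 L"
    using W2_far far by (intro continuous_on_subset[OF L_cont]) auto
  obtain \<alpha> where \<alpha>: "continuous_on W1 \<alpha>" "\<And>x. x \<in> W1 \<Longrightarrow> 3/4 < \<alpha> x \<and> \<alpha> x < 4/3"
    "\<And>x r. x \<in> W1 \<Longrightarrow> 3/4 \<le> r \<Longrightarrow> r \<le> 4/3 \<Longrightarrow> L (flow r x) - q x = 0 \<longleftrightarrow> r = \<alpha> x"
  proof (rule monotone_root_continuous[where W = W1 and lo = "3/4" and hi = "4/3"
        and F = "\<lambda>r x. L (flow r x) - q x"])
    show "continuous_on {3/4..4/3} (\<lambda>r. L (flow r x) - q x)" if "x \<in> W1" for x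
      using flow_W2[OF that]
      by (intro continuous_intros continuous_on_compose2[OF L_cont_W2]) auto
    show "continuous_on W1 (\<lambda>x. L (flow r x) - q x)" if "3/4 \<le> r" "r \<le> 4/3" for r
      using flow_W2 that
      by (intro continuous_intros continuous_on_compose2[OF L_cont_W2]) auto
  qed (use L_flow_strict_mono L_flow_ends in \<open>auto simp: W1_def\<close>)
  obtain \<beta> where \<beta>: "continuous_on W2 \<beta>" "\<And>y. y \<in> W2 \<Longrightarrow> 3/4 < \<beta> y \<and> \<beta> y < 4/3"
    "\<And>y r. y \<in> W2 \<Longrightarrow> 3/4 \<le> r \<Longrightarrow> r \<le> 4/3 \<Longrightarrow> q (flow r y) - L y = 0 \<longleftrightarrow> r = \<beta> y"
  proof (rule monotone_root_continuous[where W = W2 and lo = "3/4" and hi = "4/3"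
        and F = "\<lambda>r y. q (flow r y) - L y"])
    show "q (flow r x) - L x < q (flow s x) - L x"
      if "x \<in> W2" "3/4 \<le> r" "r < s" "s \<le> 4/3" for x r s
      using q_flow_strict_mono[OF that(2-4), of x] W2_far[OF that(1)] rho_pos by force
    show "continuous_on {3/4..4/3} (\<lambda>r. q (flow r x) - L x)" if "x \<in> W2" for x
      by (intro continuous_intros) auto
    show "continuous_on W2 (\<lambda>x. q (flow r x) - L x)" if "3/4 \<le> r" "r \<le> 4/3" for r
      using that by (intro continuous_intros L_cont_W2) auto
  qed (use flow_ends_separate W2_far in auto)
  define \<Phi> where "\<Phi> x = flow (\<alpha> x) x" for x
  define \<Psi> where "\<Psi> y = flow (\<beta> y) y" for y
  have inverse_range: "3/4 \<le> inverse r \<and> inverse r \<le> 4/3 \<and> r \<noteq> 0" if "3/4 < r" "r < 4/3" for r :: real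
    using that by (auto simp: field_simps)
  show ?thesis
  proof
    show "continuous_on {x. 4/3 * \<rho> < norm (p x)} \<Phi>"
      unfolding W1_def[symmetric] \<Phi>_def using \<alpha>(2) by (intro continuous_intros \<alpha>(1)) force
    show "continuous_on {y. \<rho> < norm (p y)} \<Psi>"
      unfolding W2_def[symmetric] \<Psi>_def using \<beta>(2) by (intro continuous_intros \<beta>(1)) force
  next
    fix x assume "4/3 * \<rho> < norm (p x)"
    then have x: "x \<in> W1" by (simp add: W1_def)
    note r = \<alpha>(2)[OF x]
    have L: "L (\<Phi> x) = q x" using \<alpha>(3)[OF x, of "\<alpha> x"] r by (simp add: \<Phi>_def)
    have y: "\<Phi> x \<in> W2" using flow_W2[OF x] r by (simp add: \<Phi>_def)
    have inv: "flow (inverse (\<alpha> x)) (\<Phi> x) = x"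
      unfolding \<Phi>_def by (rule flow_inverse) (use r in auto)
    have "inverse (\<alpha> x) = \<beta> (\<Phi> x)"
      using \<beta>(3)[OF y, of "inverse (\<alpha> x)"] inverse_range[of "\<alpha> x"] r inv L by simp
    then have "\<Psi> (\<Phi> x) = x" using inv by (simp add: \<Psi>_def)
    moreover have "norm (p (\<Phi> x)) = \<alpha> x * norm (p x)" using r by (simp add: \<Phi>_def)
    moreover have "3/4 * norm (p x) \<le> \<alpha> x * norm (p x)" "\<alpha> x * norm (p x) \<le> 4/3 * norm (p x)"
      using r by (intro mult_right_mono; simp)+
    ultimately show "L (\<Phi> x) = q x \<and> \<Psi> (\<Phi> x) = x \<and>
        3/4 * norm (p x) \<le> norm (p (\<Phi> x)) \<and> norm (p (\<Phi> x)) \<le> 4/3 * norm (p x)"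
      using L by simp
  next
    fix y assume "4/3 * \<rho> < norm (p (\<Psi> y))" "\<rho> < norm (p y)"
    then have x: "\<Psi> y \<in> W1" and y: "y \<in> W2" by (auto simp: W1_def W2_def)
    note r = \<beta>(2)[OF y]
    have L: "q (\<Psi> y) = L y" using \<beta>(3)[OF y, of "\<beta> y"] r by (simp add: \<Psi>_def)
    have inv: "flow (inverse (\<beta> y)) (\<Psi> y) = y"
      unfolding \<Psi>_def by (rule flow_inverse) (use r in auto)
    have "inverse (\<beta> y) = \<alpha> (\<Psi> y)"
      using \<alpha>(3)[OF x, of "inverse (\<beta> y)"] inverse_range[of "\<beta> y"] r inv L by simp
    then show "\<Phi> (\<Psi> y) = y" using inv by (simp add: \<Phi>_def)
  next
    fix y assume "\<rho> < norm (p y)"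
    then have "y \<in> W2" by (simp add: W2_def)
    note r = \<beta>(2)[OF this]
    then have "3/4 * norm (p y) \<le> \<beta> y * norm (p y)" by (intro mult_right_mono) auto
    then show "3/4 * norm (p y) \<le> norm (p (\<Psi> y))" using r by (simp add: \<Psi>_def)
  qed
qed

text \<open>
  The image of \<open>\<phi>\<close> is the set of points that the continuous inverse \<open>\<psi>\<close>, defined on an open set,
  maps to the domain; so it is open. It contains \<open>u + w\<close> for each \<open>w\<close> in \<open>F\<close> as soon as \<open>u\<close> in \<open>E\<close> is
  large, because \<open>\<psi>\<close> shrinks the component in \<open>E\<close> at most by a constant factor. Hence the projection
  of the image to \<open>F\<close> is all of \<open>F\<close>.
\<close>

theorem normal_form:
  obtains R \<phi> where "0 < R" "homeo_onto_open {x. R < norm (p x)} \<phi>"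
    "\<phi> ` {x. R < norm (p x)} \<subseteq> V"
    "\<And>x. R < norm (p x) \<Longrightarrow> L (\<phi> x) = (norm (p x))\<^sup>2 - (norm (m x))\<^sup>2 \<and>
       norm (p x) / sqrt (2 * norm T) \<le> norm (p (\<phi> x)) \<and>
       norm (p (\<phi> x)) \<le> norm (p x) / sqrt (a / 2)"
    "E \<noteq> {0} \<Longrightarrow> m ` \<phi> ` {x. R < norm (p x)} = F"
proof -
  obtain \<Phi> \<Psi> where cont: "continuous_on {x. 4/3 * \<rho> < norm (p x)} \<Phi>"
      "continuous_on {y. \<rho> < norm (p y)} \<Psi>"
    and \<Phi>: "\<And>x. 4/3 * \<rho> < norm (p x) \<Longrightarrow> L (\<Phi> x) = q x \<and> \<Psi> (\<Phi> x) = x \<and>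
        3/4 * norm (p x) \<le> norm (p (\<Phi> x)) \<and> norm (p (\<Phi> x)) \<le> 4/3 * norm (p x)"
    and \<Phi>\<Psi>: "\<And>y. 4/3 * \<rho> < norm (p (\<Psi> y)) \<Longrightarrow> \<rho> < norm (p y) \<Longrightarrow> \<Phi> (\<Psi> y) = y"
    and \<Psi>: "\<And>y. \<rho> < norm (p y) \<Longrightarrow> 3/4 * norm (p y) \<le> norm (p (\<Psi> y))"
    using straightening by blast
  define N where "N = sqrt (norm T / 2)"
  \<comment> \<open>The stretch divides norms at most by N, so beyond R it lands in the domain of \<Phi>; the summand 1
    keeps R positive when N = 0.\<close>
  define R where "R = 4/3 * \<rho> * N + 1"
  have N: "0 \<le> N" by (simp add: N_def)
  have R: "0 < R" unfolding R_def using N rho_pos by (intro add_nonneg_pos) auto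
  define D where "D = {x. R < norm (p x)}"
  have pE: "p x \<in> E \<union> F" for x using p_in by blast
  have D_far: "4/3 * \<rho> < norm (p (stretch2 x))" if "x \<in> D" for x
  proof -
    have "0 < norm (p x)" using that R by (auto simp: D_def)
    have "N \<noteq> 0"
    proof
      assume "N = 0"
      then have "q (p x) = 0" using q_bounded[of "p x"] by (auto simp: N_def)
      then show False using q_nonzero[OF pE, of x] \<open>0 < norm (p x)\<close> by auto
    qed
    then have "0 < N" using N by simp
    then have "4/3 * \<rho> < R / N" by (simp add: R_def field_simps)
    also have "\<dots> \<le> norm (p x) / N" using that N by (intro divide_right_mono) (auto simp: D_def)
    also have "\<dots> \<le> norm (p (stretch2 x))" using norm_stretch(1)[OF pE, of x] by (simp add: N_def)
    finally show ?thesis .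
  qed
  define \<phi> where "\<phi> x = \<Phi> (stretch2 x)" for x
  define \<psi> where "\<psi> y = unstretch2 (\<Psi> y)" for y
  define U where "U = {y. \<rho> < norm (p y)} \<inter> \<psi> -` D"
  have \<psi>_cont: "continuous_on {y. \<rho> < norm (p y)} \<psi>"
    unfolding \<psi>_def by (rule continuous_on_compose2[OF continuous_stretch2(2) cont(2)]) auto
  have \<psi>\<phi>: "\<psi> (\<phi> x) = x" and \<phi>_far: "\<rho> < norm (p (\<phi> x))" if "x \<in> D" for x
    using \<Phi>[OF D_far[OF that]] D_far[OF that]
    by (auto simp: \<phi>_def \<psi>_def unstretch2_stretch2)
  have \<phi>\<psi>: "\<phi> (\<psi> y) = y" if "y \<in> U" for y
  proof -
    have "4/3 * \<rho> < norm (p (\<Psi> y))"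
      using D_far[of "\<psi> y"] that by (simp add: U_def \<psi>_def stretch2_unstretch2)
    then show ?thesis
      using \<Phi>\<Psi>[of y] that by (simp add: U_def \<phi>_def \<psi>_def stretch2_unstretch2)
  qed
  have img: "\<phi> ` D = U"
  proof
    show "\<phi> ` D \<subseteq> U" using \<psi>\<phi> \<phi>_far by (auto simp: U_def)
    show "U \<subseteq> \<phi> ` D" using \<phi>\<psi> by (force simp: U_def)
  qed
  have "open D" "open {y. \<rho> < norm (p y)}"
    unfolding D_def by (intro open_Collect_less continuous_intros)+
  then have "open U"
    unfolding U_def using continuous_open_preimage[OF \<psi>_cont] by blast
  moreover have "homeomorphism D U \<phi> \<psi>"
  proof (rule homeomorphismI)
    show "continuous_on D \<phi>"
      unfolding \<phi>_def
      by (rule continuous_on_compose2[OF cont(1) continuous_on_subset[OF continuous_stretch2(1)]])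
        (use D_far in auto)
    show "continuous_on U \<psi>"
      by (rule continuous_on_subset[OF \<psi>_cont]) (auto simp: U_def)
  qed (use img \<psi>\<phi> \<phi>\<psi> in \<open>auto simp: U_def\<close>)
  ultimately have homeo: "homeo_onto_open D \<phi>"
    unfolding homeo_onto_open_def img by blast
  show ?thesis
  proof (rule that[of R \<phi>])
    show "homeo_onto_open {x. R < norm (p x)} \<phi>" using homeo by (simp add: D_def)
    have "U \<subseteq> V"
      using norm_p_le far by (auto simp: U_def intro: less_le_trans)
    then show "\<phi> ` {x. R < norm (p x)} \<subseteq> V" using img by (simp add: D_def)
  next
    fix x assume "R < norm (p x)"
    then have x: "x \<in> D" by (simp add: D_def)
    note P = \<Phi>[OF D_far[OF x], folded \<phi>_def]
    have "norm (p x) / sqrt (2 * norm T) = norm (p x) / N * (1/2)"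
    proof -
      have "sqrt (2 * norm T) = sqrt (4 * (norm T / 2))" by simp
      also have "\<dots> = 2 * N" unfolding N_def by (subst real_sqrt_mult) simp
      finally show ?thesis by simp
    qed
    also have "\<dots> \<le> norm (p x) / N * (3/4)" using N by (intro mult_left_mono) auto
    also have "\<dots> \<le> 3/4 * norm (stretch (p x))" using norm_stretch(1)[OF pE, of x] by (simp add: N_def)
    also have "\<dots> \<le> norm (p (\<phi> x))" using P by simp
    finally have lower: "norm (p x) / sqrt (2 * norm T) \<le> norm (p (\<phi> x))" .
    have "norm (p (\<phi> x)) \<le> 4/3 * norm (stretch (p x))" using P by simp
    also have "\<dots> \<le> 4/3 * (norm (p x) / sqrt a)"
      using norm_stretch(2)[OF pE, of x] by (intro mult_left_mono) auto
    also have "\<dots> \<le> sqrt 2 * (norm (p x) / sqrt a)"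
      using a_pos by (intro mult_right_mono real_le_rsqrt) (auto simp: power2_eq_square)
    also have "\<dots> = norm (p x) / sqrt (a / 2)" by (simp add: real_sqrt_divide)
    finally show "L (\<phi> x) = (norm (p x))\<^sup>2 - (norm (m x))\<^sup>2 \<and>
       norm (p x) / sqrt (2 * norm T) \<le> norm (p (\<phi> x)) \<and>
       norm (p (\<phi> x)) \<le> norm (p x) / sqrt (a / 2)"
      using P lower by (simp add: q_stretch2)
  next
    assume "E \<noteq> {0}"
    then obtain e where e: "e \<in> E" "e \<noteq> 0" using subspace_0[OF subspace_E] by blast
    have "w \<in> m ` \<phi> ` D" if w: "w \<in> F" for w
    proof -
      \<comment> \<open>Sliding costs a factor of at most 4/3, and unstretching a factor of at most 1 / sqrt a.\<close>
      define k where "k = (R / sqrt a * (4/3) + \<rho> + 1) / norm e"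
      define y where "y = k *\<^sub>R e + w"
      have "0 \<le> R / sqrt a * (4/3)" using R a_pos by simp
      then have k: "norm (k *\<^sub>R e) = R / sqrt a * (4/3) + \<rho> + 1"
        using e rho_pos by (simp add: k_def)
      have py: "p y = k *\<^sub>R e" using e w by (simp add: y_def)
      then have my: "m y = w" by (simp add: m_def y_def)
      have y_far: "\<rho> < norm (p y)" using k \<open>0 \<le> R / sqrt a * (4/3)\<close> by (simp add: py)
      have "R / sqrt a < 3/4 * norm (p y)" using k rho_pos by (simp add: py)
      also have "\<dots> \<le> norm (p (\<Psi> y))" by (rule \<Psi>[OF y_far])
      also have "\<dots> = norm (stretch (p (\<psi> y)))"
        by (simp add: \<psi>_def stretch_unstretch[OF pE])
      also have "\<dots> \<le> norm (p (\<psi> y)) / sqrt a" by (rule norm_stretch(2)[OF pE])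
      finally have "R < norm (p (\<psi> y))" using a_pos by (simp add: divide_less_cancel)
      then have "\<psi> y \<in> D" by (simp add: D_def)
      then have "y \<in> \<phi> ` D" using y_far by (simp add: img U_def)
      then show ?thesis using my by blast
    qed
    then show "m ` \<phi> ` {x. R < norm (p x)} = F" using m_in_F by (auto simp: D_def)
  qed (fact R)
qed

end

section \<open>The normal form at infinity\<close>

theorem corollary1p9:
  fixes j :: "'x::banach \<Rightarrow> 'h::{real_inner, complete_space}"
    and V :: "'h set"
    and L :: "'h \<Rightarrow> real"
    and A :: "'x \<Rightarrow> 'x"
    and B P Q :: "'x \<Rightarrow> 'h \<Rightarrow>\<^sub>L 'h"
    and Binf Pinf Qinf :: "'h \<Rightarrow>\<^sub>L 'h"
    and Hp Hm :: "'h set"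
    and a lam :: real
    and mu :: enat
  assumes j_linear: "linear j"
    and j_inj: "inj j"
    and j_norm: "\<And>x. norm (j x) \<le> norm x"
    and j_dense: "closure (range j) = UNIV"
    and V_open: "open V"
    and V_nbhd: "neighborhood_of_infinity V"
    and L_cont: "continuous_on V L"
    and L_diff: "continuously_dir_differentiable_on V L"
    and A_cont: "continuous_on (j -` V) A"
    and A_diff: "continuously_dir_differentiable_on (j -` V) A"
    and A_grad: "\<And>x u. j x \<in> V \<Longrightarrow> dir_deriv L (j x) (j u) = j (A x) \<bullet> j u"
    and B_sa: "\<And>x. j x \<in> V \<Longrightarrow> self_adjoint (B x)"
    and Binf_sa: "self_adjoint Binf"
    and Binf_X: "blinfun_apply Binf ` range j \<subseteq> range j"
    and A_deriv: "\<And>x u v. j x \<in> V \<Longrightarrow> j (dir_deriv A x u) \<bullet> j v = B x (j u) \<bullet> j v"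
    and spectrum0: "0 \<notin> op_spectrum Binf \<or> 0 isolated_in op_spectrum Binf"
    and Binf_reg: "\<And>u. Binf u \<in> range j \<Longrightarrow> u \<in> range j"
    and B_split: "\<And>x. j x \<in> V \<Longrightarrow> B x = P x + Q x"
    and Binf_split: "Binf = Pinf + Qinf"
    and P_pos: "\<And>x. j x \<in> V \<Longrightarrow> positive_definite (P x)"
    and Pinf_pos: "positive_definite Pinf"
    and Q_compact: "\<And>x. j x \<in> V \<Longrightarrow> compact_operator (Q x)"
    and Qinf_compact: "compact_operator Qinf"
    and eigen_X: "\<And>c u. c < 0 \<Longrightarrow> u \<noteq> 0 \<Longrightarrow> Binf u = c *\<^sub>R u \<Longrightarrow> u \<in> range j"
    and P_conv: "\<And>xs u. (\<And>k. j (xs k) \<in> V) \<Longrightarrow>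
           filterlim (\<lambda>k. norm (j (xs k))) at_top sequentially \<Longrightarrow>
           (\<lambda>k. norm (P (xs k) u - Pinf u)) \<longlonglongrightarrow> 0"
    and Q_conv: "((\<lambda>x. norm (Q x - Qinf)) \<longlongrightarrow> 0)
           (inf (filtercomap (\<lambda>x. norm (j x)) at_top) (principal (j -` V)))"
    and P_coercive: "\<And>xs. (\<And>n. j (xs n) \<in> V) \<Longrightarrow>
           filterlim (\<lambda>n. norm (j (xs n))) at_top sequentially \<Longrightarrow>
           \<exists>C0>0. \<exists>n0. \<forall>n\<ge>n0. \<forall>u. P (xs n) u \<bullet> u \<ge> C0 * (norm u)\<^sup>2"
    and nullity: "edim (op_kernel Binf) = 0"
    and L_asymp: "(\<lambda>u. L u - (Binf u \<bullet> u) / 2) \<in> o[at_infinity](\<lambda>u. (norm u)\<^sup>2)"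
    and A_asymp: "(\<lambda>x. norm (j (A x) - Binf (j x)))
           \<in> o[filtercomap (\<lambda>x. norm (j x)) at_top](\<lambda>x. norm (j x))"
    and Hp_def: "Hp = positive_subspace Binf"
    and Hm_def: "Hm = negative_subspace Binf"
    and mu_def: "mu = edim Hm"
    and a_pos: "a > 0"
    and a_plus: "\<And>u. u \<in> Hp \<Longrightarrow> Binf u \<bullet> u \<ge> 2 * a * (norm u)\<^sup>2"
    and a_minus: "\<And>u. u \<in> Hm \<Longrightarrow> Binf u \<bullet> u \<le> - 2 * a * (norm u)\<^sup>2"
    and lam_def: "lam = a / 2"
  shows "(mu = 0 \<longrightarrow>
           (\<exists>R>0. \<exists>\<phi> :: 'h \<Rightarrow> 'h. let D = ball_infinity (UNIV :: 'h set) R in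
              homeo_onto_open D \<phi> \<and> \<phi> ` D \<subseteq> V \<and>
              (\<forall>u\<in>D. L (\<phi> u) = (norm u)\<^sup>2 \<and>
                 norm u / sqrt (2 * norm Binf) \<le> norm (\<phi> u) \<and>
                 norm (\<phi> u) \<le> 1 / sqrt (a - lam) * norm u)))
       \<and> (mu > 0 \<longrightarrow>
           (\<exists>R>0. \<exists>\<phi> :: 'h \<Rightarrow> 'h. let D = {u + v | u v. u \<in> ball_infinity Hp R \<and> v \<in> Hm} in
              homeo_onto_open D \<phi> \<and> \<phi> ` D \<subseteq> V \<and>
              (\<forall>u\<in>ball_infinity Hp R. \<forall>v\<in>Hm.
                 L (\<phi> (u + v)) = (norm u)\<^sup>2 - (norm v)\<^sup>2 \<and>
                 norm u / sqrt (2 * norm Binf) \<le> norm (orth_proj Hp (\<phi> (u + v))) \<and>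
                 norm (orth_proj Hp (\<phi> (u + v))) \<le> norm u / sqrt (a - lam)) \<and>
              (Hp \<noteq> {0} \<longrightarrow> orth_proj Hm ` \<phi> ` D = Hm)))"
proof -
  obtain R0 where R0: "R0 > 0" "\<And>z. norm z > R0 \<Longrightarrow> z \<in> V"
    using V_nbhd by (auto simp: neighborhood_of_infinity_def ball_infinity_def)
  \<comment> \<open>Coercivity passes to the limit along a sequence that goes to infinity on a ray of X. Such a ray
    exists unless the Hilbert space is trivial, and then every constant will do.\<close>
  have "\<exists>C>0. \<forall>u. C * (norm u)\<^sup>2 \<le> Pinf u \<bullet> u"
  proof (cases "\<exists>x0. j x0 \<noteq> 0")
    case True
    then obtain x0 where x0: "j x0 \<noteq> 0" by blast
    define xs where "xs n = ((R0 + 1 + real n) / norm (j x0)) *\<^sub>R x0" for n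
    have norm_xs: "norm (j (xs n)) = R0 + 1 + real n" for n
      using x0 R0(1) by (simp add: xs_def linear_cmul[OF j_linear])
    have xs_V: "j (xs n) \<in> V" for n
      by (rule R0(2)) (simp add: norm_xs)
    have xs_inf: "filterlim (\<lambda>n. norm (j (xs n))) at_top sequentially"
      unfolding norm_xs
      by (rule filterlim_tendsto_add_at_top[OF tendsto_const filterlim_real_sequentially])
    obtain C n0 where C: "C > 0" "\<And>n u. n \<ge> n0 \<Longrightarrow> C * (norm u)\<^sup>2 \<le> P (xs n) u \<bullet> u"
      using P_coercive[of xs, OF xs_V xs_inf] by blast
    have "C * (norm u)\<^sup>2 \<le> Pinf u \<bullet> u" for u
    proof (rule LIMSEQ_le_const)
      have "(\<lambda>n. P (xs n) u - Pinf u) \<longlonglongrightarrow> 0"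
        using P_conv[of xs u, OF xs_V xs_inf] by (rule tendsto_norm_zero_cancel)
      then have "(\<lambda>n. P (xs n) u) \<longlonglongrightarrow> Pinf u" by (rule LIM_zero_cancel)
      then show "(\<lambda>n. P (xs n) u \<bullet> u) \<longlonglongrightarrow> Pinf u \<bullet> u"
        by (rule tendsto_inner[OF _ tendsto_const])
      show "\<exists>N. \<forall>n\<ge>N. C * (norm u)\<^sup>2 \<le> P (xs n) u \<bullet> u" using C(2) by blast
    qed
    with C(1) show ?thesis by blast
  next
    case False
    then have "range j = {0}" by auto
    then have "u = 0" for u :: 'h using j_dense by auto
    then show ?thesis by (intro exI[of _ 1]) (metis inner_zero_right mult_zero_right norm_zero order_refl power_zero_numeral zero_less_one)
  qed
  then obtain C where C: "\<And>u. C * (norm u)\<^sup>2 \<le> Pinf u \<bullet> u" "C > 0" by blast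
  have ker: "u = 0" if "Binf u = 0" for u
    using edim_eq_0D[OF nullity] that by (auto simp: op_kernel_def)
  obtain S where S: "finite S" "orthonormal S" and eig: "\<forall>e\<in>S. \<exists>c<0. Binf e = c *\<^sub>R e"
    and Hp: "Hp = {u. \<forall>e\<in>S. u \<bullet> e = 0}" and Hm: "Hm = span S"
    using spectral_subspaces_negative_eigenbasis[OF Binf_sa Binf_split Qinf_compact C ker]
    unfolding Hp_def Hm_def by blast
  define p where "p x = x - proj_span S x" for x
  have Hp_orth: "u \<bullet> v = 0" if "u \<in> Hp" "v \<in> Hm" for u v
    using inner_span_zero[of v S u] that by (auto simp: Hp Hm)
  have Binf_Hp: "Binf u \<in> Hp" if "u \<in> Hp" for u
    using that eig inner_eigenvector_image_zero[OF Binf_sa] unfolding Hp by blast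
  obtain b1 where b1: "\<And>u. b1 \<le> norm u \<Longrightarrow> \<bar>L u - (Binf u \<bullet> u) / 2\<bar> \<le> a / 20 * (norm u)\<^sup>2"
    using landau_o.smallD[OF L_asymp, of "a / 20"] a_pos by (auto simp: eventually_at_infinity)
  obtain b2 where b2: "\<And>x. b2 \<le> norm (j x) \<Longrightarrow> norm (j (A x) - Binf (j x)) \<le> a / 20 * norm (j x)"
    using landau_o.smallD[OF A_asymp, of "a / 20"] a_pos
    by (auto simp: eventually_filtercomap_at_top_linorder)
  define \<rho> where "\<rho> = max R0 (max b1 b2)"
  interpret asymptotic_saddle Binf Hp Hm p a V L \<rho>
  proof (intro asymptotic_saddle.intro split_form.intro asymptotic_saddle_axioms.intro)
    show "subspace Hp" by (auto simp: Hp subspace_def inner_add_left)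
    show "subspace Hm" unfolding Hm by (rule subspace_span)
    show "bounded_linear p"
      unfolding p_def by (intro bounded_linear_sub bounded_linear_ident bounded_linear_proj_span)
    show "p x \<in> Hp" for x
      unfolding Hp p_def using residual_orthogonal_span[OF S] span_base by blast
    show "x - p x \<in> Hm" for x by (simp add: p_def Hm proj_span_in_span)
    show "u \<bullet> v = 0" if "u \<in> Hp" "v \<in> Hm" for u v using Hp_orth that .
    show "Binf u \<bullet> v = 0" if "u \<in> Hp" "v \<in> Hm" for u v using Hp_orth Binf_Hp that by blast
    show "Binf v \<bullet> u = 0" if "u \<in> Hp" "v \<in> Hm" for u v
      using Hp_orth[OF Binf_Hp[OF that(1)] that(2)] Binf_sa by (metis inner_commute self_adjoint_def)
    show "\<bar>(L y - (Binf y \<bullet> y) / 2) - (L x - (Binf x \<bullet> x) / 2)\<bar>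
        \<le> a / 20 * max (norm x) (norm y) * norm (y - x)"
      if "\<And>z. z \<in> closed_segment x y \<Longrightarrow> \<rho> < norm z" for x y
      by (rule gradient_error_imp_lipschitz[OF j_linear Binf_sa j_dense L_diff V_open L_cont A_grad,
            where \<rho> = \<rho>])
        (use R0(2) b2 a_pos that in \<open>auto simp: \<rho>_def\<close>)
  qed (use R0 b1 a_pos a_plus a_minus L_cont in \<open>auto simp: \<rho>_def\<close>)
  obtain R \<phi> where R: "0 < R" and homeo: "homeo_onto_open {x. R < norm (p x)} \<phi>"
    and img: "\<phi> ` {x. R < norm (p x)} \<subseteq> V"
    and \<phi>: "\<And>x. R < norm (p x) \<Longrightarrow> L (\<phi> x) = (norm (p x))\<^sup>2 - (norm (m x))\<^sup>2 \<and>
       norm (p x) / sqrt (2 * norm Binf) \<le> norm (p (\<phi> x)) \<and>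
       norm (p (\<phi> x)) \<le> norm (p x) / sqrt (a / 2)"
    and onto: "Hp \<noteq> {0} \<Longrightarrow> m ` \<phi> ` {x. R < norm (p x)} = Hm"
    using normal_form by blast
  have lam: "a - lam = a / 2" by (simp add: lam_def)
  have proj_p: "orth_proj Hp x = p x" for x
    by (rule orth_proj_eq[OF subspace_E p_in]) (use orth m_in in \<open>auto simp: inner_commute\<close>)
  have proj_m: "orth_proj Hm = m"
    by (rule ext, rule orth_proj_eq[OF subspace_F m_in_F]) (use orth p_in in \<open>auto simp: m_def\<close>)
  show ?thesis
  proof (intro conjI impI)
    assume "mu = 0"
    then have "Hm \<subseteq> {0}" using edim_eq_0D mu_def by simp
    then have "m x = 0" for x using m_in_F by blast
    then have px: "p x = x" and mx: "m x = 0" for x using decompose[of x] by simp_all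
    \<comment> \<open>Now p is the identity, and the domain of the normal form is the exterior of a ball.\<close>
    show "\<exists>R>0. \<exists>\<phi>. let D = ball_infinity (UNIV :: 'h set) R in
              homeo_onto_open D \<phi> \<and> \<phi> ` D \<subseteq> V \<and>
              (\<forall>u\<in>D. L (\<phi> u) = (norm u)\<^sup>2 \<and>
                 norm u / sqrt (2 * norm Binf) \<le> norm (\<phi> u) \<and>
                 norm (\<phi> u) \<le> 1 / sqrt (a - lam) * norm u)"
      using R homeo img \<phi> unfolding px mx lam Let_def ball_infinity_def
      by (intro exI[of _ R] conjI exI[of _ \<phi>]) simp_all
  next
    have D: "{u + v | u v. u \<in> ball_infinity Hp R \<and> v \<in> Hm} = {x. R < norm (p x)}"
    proof (intro set_eqI iffI)
      fix x assume "x \<in> {x. R < norm (p x)}"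
      then have "x = p x + m x \<and> p x \<in> ball_infinity Hp R \<and> m x \<in> Hm"
        by (simp add: decompose ball_infinity_def p_in m_in_F)
      then show "x \<in> {u + v | u v. u \<in> ball_infinity Hp R \<and> v \<in> Hm}" by blast
    qed (auto simp: ball_infinity_def)
    have "L (\<phi> (u + v)) = (norm u)\<^sup>2 - (norm v)\<^sup>2 \<and>
        norm u / sqrt (2 * norm Binf) \<le> norm (orth_proj Hp (\<phi> (u + v))) \<and>
        norm (orth_proj Hp (\<phi> (u + v))) \<le> norm u / sqrt (a - lam)"
      if "u \<in> ball_infinity Hp R" "v \<in> Hm" for u v
    proof -
      have "p (u + v) = u" "m (u + v) = v" "R < norm u"
        using that by (auto simp: ball_infinity_def m_def)
      then show ?thesis using \<phi>[of "u + v"] by (simp only: proj_p lam)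
    qed
    then show "\<exists>R>0. \<exists>\<phi>. let D = {u + v | u v. u \<in> ball_infinity Hp R \<and> v \<in> Hm} in
              homeo_onto_open D \<phi> \<and> \<phi> ` D \<subseteq> V \<and>
              (\<forall>u\<in>ball_infinity Hp R. \<forall>v\<in>Hm.
                 L (\<phi> (u + v)) = (norm u)\<^sup>2 - (norm v)\<^sup>2 \<and>
                 norm u / sqrt (2 * norm Binf) \<le> norm (orth_proj Hp (\<phi> (u + v))) \<and>
                 norm (orth_proj Hp (\<phi> (u + v))) \<le> norm u / sqrt (a - lam)) \<and>
              (Hp \<noteq> {0} \<longrightarrow> orth_proj Hm ` \<phi> ` D = Hm)"
      unfolding Let_def using R homeo img onto
      by (intro exI[of _ R] conjI exI[of _ \<phi>]) (simp_all only: D proj_m, auto)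
  qed
qed

end
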